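(* Let $\gamma(s)$ be a partially null curve in $E_1^4$ with Frenet vector fields $F_1,F_2,F_3,F_4$. The canal hypersurfaces that are formed as the envelope of a family of pseudo hyperspheres with radius function $r(s)$ whose centers lie on $\gamma(s)$ can be parametrized by $$C_1(s,t,w)=\gamma-rr'F_1\mp r\sqrt{1-r'^2}\left(\sin f\,F_2+g\cos f\,F_3+\frac{\cos f}{2g}F_4\right),$$ $$C_2(s,t,w)=\gamma-rr'F_1\mp r\sqrt{1-r'^2}\left(\cos f\,F_2+g\sin f\,F_3+\frac{\sin f}{2g}F_4\right),$$ $$C_3(s,t,w)=\gamma-rr'F_1\mp r\sqrt{1-r'^2}\left(\cosh f\,F_2+g\sinh f\,F_3-\frac{\sinh f}{2g}F_4\right),$$ $$C_4(s,t,w)=\gamma-rr'F_1\mp r\sqrt{r'^2-1}\left(\sinh f\,F_2+g\cosh f\,F_3-\frac{\cosh f}{2g}F_4\right),$$ where $r'(s)^2<1$ is supposed for $C_1,C_2,C_3$ and $r'(s)^2>1$ for $C_4$. Furthermore, the canal hypersurfaces that are formed as the envelope of a family of pseudo hyperbolic hyperspheres with radius function $r(s)$ whose centers lie on $\gamma(s)$ can be parametrized by $$C_5(s,t,w)=\gamma+rr'F_1\mp r\sqrt{1+r'^2}\left(\sinh f\,F_2+g\cosh f\,F_3-\frac{\cosh f}{2g}F_4\right).$$ Here the canal hypersurfaces $C_1,C_2,C_3,C_4$ are timelike and the canal hypersurface $C_5$ is spacelike.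
   Context: $E_1^4$ is $\mathbb{R}^4$ with $\langle u,v\rangle=-u_1v_1+u_2v_2+u_3v_3+u_4v_4$. A partially null curve is a unit speed spacelike curve $\gamma(s)$ whose binormal is null; it has a Frenet frame $F_1=\gamma',F_2,F_3,F_4$ with $\langle F_1,F_1\rangle=\langle F_2,F_2\rangle=\langle F_3,F_4\rangle=1$, all other products $\langle F_i,F_j\rangle$ zero, and $F_1'=k_1F_2$, $F_2'=-k_1F_1+k_2F_3$, $F_3'=k_3F_3$, $F_4'=-k_2F_2-k_3F_4$, where $k_3=0$ for all $s$. The pseudo hypersphere (resp. pseudo hyperbolic hypersphere) with center $p$ and radius $r>0$ is $\{u:\langle u-p,u-p\rangle=r^2\}$ (resp. $\{u:\langle u-p,u-p\rangle=-r^2\}$). With $\lambda=1$ for pseudo hyperspheres and $\lambda=-1$ for pseudo hyperbolic hyperspheres, a hypersurface $C(s,t,w)$ is (formed as) the envelope of the family with centers $\gamma(s)$ and radius function $r(s)>0$ if $\langle C-\gamma,C-\gamma\rangle=\lambda r^2$ and $C(s,t,w)-\gamma(s)$ is normal to the hypersurface (in particular $\langle C-\gamma,\partial C/\partial s\rangle=0$). Here $r=r(s)$, $r'=dr/ds$, and $f=f(t,w)$, $g=g(t,w)$ are smooth real functions with $g$ nowhere zero; $\mp$ means either sign may be chosen. A (regular) hypersurface is timelike if its unit normal is spacelike ($\langle N,N\rangle=1$), and spacelike if its unit normal is timelike ($\langle N,N\rangle=-1$).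
   Formalization: For r'^2<1, that every regular canal hypersurface is parametrized by C_1, C_2, C_3 is shown only on the dense part where the F_3 and F_4 coefficients of C-γ are both nonzero: points with exactly one of them zero lie on none of C_1, C_2, C_3. *)

theory Defs
  imports "HOL-Analysis.Analysis"
begin

definition lorentz :: "real^4 \<Rightarrow> real^4 \<Rightarrow> real" where
  "lorentz u v = - (u$1 * v$1) + u$2 * v$2 + u$3 * v$3 + u$4 * v$4"

definition pseudo_hypersphere :: "real^4 \<Rightarrow> real \<Rightarrow> (real^4) set" where
  "pseudo_hypersphere c \<rho> = {u. lorentz (u - c) (u - c) = \<rho>\<^sup>2}"

definition pseudo_hyperbolic_hypersphere :: "real^4 \<Rightarrow> real \<Rightarrow> (real^4) set" where
  "pseudo_hyperbolic_hypersphere c \<rho> = {u. lorentz (u - c) (u - c) = - \<rho>\<^sup>2}"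

(* k times continuously differentiable; meant for open S *)
fun Ck_on :: "nat \<Rightarrow> 'a::euclidean_space set \<Rightarrow> ('a \<Rightarrow> 'b::real_normed_vector) \<Rightarrow> bool" where
  "Ck_on 0 S f = continuous_on S f"
| "Ck_on (Suc k) S f =
     ((\<forall>x\<in>S. f differentiable (at x)) \<and>
      (\<forall>v. Ck_on k S (\<lambda>x. frechet_derivative f (at x) v)))"

definition smooth_on :: "'a::euclidean_space set \<Rightarrow> ('a \<Rightarrow> 'b::real_normed_vector) \<Rightarrow> bool" where
  "smooth_on S f \<longleftrightarrow> (\<forall>k. Ck_on k S f)"

locale partially_null_curve =
  fixes I :: "real set"
    and \<gamma> F1 F2 F3 F4 :: "real \<Rightarrow> real^4"
    and k1 k2 k3 :: "real \<Rightarrow> real"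
  assumes interval: "open I" "is_interval I"
    and smooth: "smooth_on I \<gamma>" "smooth_on I F1" "smooth_on I F2" "smooth_on I F3" "smooth_on I F4"
    and products_1: "s \<in> I \<Longrightarrow> lorentz (F1 s) (F1 s) = 1"
      "s \<in> I \<Longrightarrow> lorentz (F2 s) (F2 s) = 1"
      "s \<in> I \<Longrightarrow> lorentz (F3 s) (F4 s) = 1"
    and products_0: "s \<in> I \<Longrightarrow> lorentz (F3 s) (F3 s) = 0"
      "s \<in> I \<Longrightarrow> lorentz (F4 s) (F4 s) = 0"
      "s \<in> I \<Longrightarrow> lorentz (F1 s) (F2 s) = 0"
      "s \<in> I \<Longrightarrow> lorentz (F1 s) (F3 s) = 0"
      "s \<in> I \<Longrightarrow> lorentz (F1 s) (F4 s) = 0"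
      "s \<in> I \<Longrightarrow> lorentz (F2 s) (F3 s) = 0"
      "s \<in> I \<Longrightarrow> lorentz (F2 s) (F4 s) = 0"
    and frenet: "s \<in> I \<Longrightarrow> (\<gamma> has_vector_derivative F1 s) (at s)"
      "s \<in> I \<Longrightarrow> (F1 has_vector_derivative k1 s *\<^sub>R F2 s) (at s)"
      "s \<in> I \<Longrightarrow> (F2 has_vector_derivative - k1 s *\<^sub>R F1 s + k2 s *\<^sub>R F3 s) (at s)"
      "s \<in> I \<Longrightarrow> (F3 has_vector_derivative k3 s *\<^sub>R F3 s) (at s)"
      "s \<in> I \<Longrightarrow> (F4 has_vector_derivative - k2 s *\<^sub>R F2 s - k3 s *\<^sub>R F4 s) (at s)"
    and k3_zero: "s \<in> I \<Longrightarrow> k3 s = 0"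

(* A parametrized hypersurface is a map X on an open set of parameters (s, t, w). Its tangent
   space at p is the range of the derivative of X at p. *)

definition regular_at :: "(real \<times> real \<times> real \<Rightarrow> real^4) \<Rightarrow> real \<times> real \<times> real \<Rightarrow> bool" where
  "regular_at X p \<longleftrightarrow> X differentiable (at p) \<and> inj (frechet_derivative X (at p))"

definition normal_at :: "(real \<times> real \<times> real \<Rightarrow> real^4) \<Rightarrow> real \<times> real \<times> real \<Rightarrow> real^4 \<Rightarrow> bool" where
  "normal_at X p N \<longleftrightarrow> (\<forall>v. lorentz N (frechet_derivative X (at p) v) = 0)"

definition unit_normal_at :: "(real \<times> real \<times> real \<Rightarrow> real^4) \<Rightarrow> real \<times> real \<times> real \<Rightarrow> real^4 \<Rightarrow> bool" where
  "unit_normal_at X p N \<longleftrightarrow> normal_at X p N \<and> \<bar>lorentz N N\<bar> = 1"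

(* Causal character is a condition at regular points only. Existence of a unit normal is required
   because a hypersurface with null normal has none. *)

definition timelike_on :: "(real \<times> real \<times> real) set \<Rightarrow> (real \<times> real \<times> real \<Rightarrow> real^4) \<Rightarrow> bool" where
  "timelike_on U X \<longleftrightarrow> (\<forall>p\<in>U. regular_at X p \<longrightarrow>
     (\<exists>N. unit_normal_at X p N) \<and> (\<forall>N. unit_normal_at X p N \<longrightarrow> lorentz N N = 1))"

definition spacelike_on :: "(real \<times> real \<times> real) set \<Rightarrow> (real \<times> real \<times> real \<Rightarrow> real^4) \<Rightarrow> bool" where
  "spacelike_on U X \<longleftrightarrow> (\<forall>p\<in>U. regular_at X p \<longrightarrow>
     (\<exists>N. unit_normal_at X p N) \<and> (\<forall>N. unit_normal_at X p N \<longrightarrow> lorentz N N = -1))"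

definition envelope_on ::
  "real set \<Rightarrow> (real \<Rightarrow> real^4) \<Rightarrow> (real \<Rightarrow> (real^4) set) \<Rightarrow>
   (real \<times> real \<times> real) set \<Rightarrow> (real \<times> real \<times> real \<Rightarrow> real^4) \<Rightarrow> bool" where
  "envelope_on I \<gamma> \<Sigma> U X \<longleftrightarrow>
     open U \<and> U \<subseteq> I \<times> UNIV \<and> smooth_on U X \<and>
     (\<forall>p\<in>U. X p \<in> \<Sigma> (fst p) \<and> normal_at X p (X p - \<gamma> (fst p)))"

(* In canal1, ..., canal5 the argument \<epsilon> in {-1, 1} is the choice of sign in front of the
   square root. *)

definition canal1 where
  "canal1 \<gamma> F1 F2 F3 F4 (r :: real \<Rightarrow> real) \<epsilon> f g = (\<lambda>(s, t, w).
     \<gamma> s - (r s * deriv r s) *\<^sub>R F1 s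
       + (\<epsilon> * r s * sqrt (1 - (deriv r s)\<^sup>2)) *\<^sub>R
         (sin (f (t, w)) *\<^sub>R F2 s + (g (t, w) * cos (f (t, w))) *\<^sub>R F3 s
          + (cos (f (t, w)) / (2 * g (t, w))) *\<^sub>R F4 s) :: real^4)"

definition canal2 where
  "canal2 \<gamma> F1 F2 F3 F4 (r :: real \<Rightarrow> real) \<epsilon> f g = (\<lambda>(s, t, w).
     \<gamma> s - (r s * deriv r s) *\<^sub>R F1 s
       + (\<epsilon> * r s * sqrt (1 - (deriv r s)\<^sup>2)) *\<^sub>R
         (cos (f (t, w)) *\<^sub>R F2 s + (g (t, w) * sin (f (t, w))) *\<^sub>R F3 s
          + (sin (f (t, w)) / (2 * g (t, w))) *\<^sub>R F4 s) :: real^4)"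

definition canal3 where
  "canal3 \<gamma> F1 F2 F3 F4 (r :: real \<Rightarrow> real) \<epsilon> f g = (\<lambda>(s, t, w).
     \<gamma> s - (r s * deriv r s) *\<^sub>R F1 s
       + (\<epsilon> * r s * sqrt (1 - (deriv r s)\<^sup>2)) *\<^sub>R
         (cosh (f (t, w)) *\<^sub>R F2 s + (g (t, w) * sinh (f (t, w))) *\<^sub>R F3 s
          - (sinh (f (t, w)) / (2 * g (t, w))) *\<^sub>R F4 s) :: real^4)"

definition canal4 where
  "canal4 \<gamma> F1 F2 F3 F4 (r :: real \<Rightarrow> real) \<epsilon> f g = (\<lambda>(s, t, w).
     \<gamma> s - (r s * deriv r s) *\<^sub>R F1 s
       + (\<epsilon> * r s * sqrt ((deriv r s)\<^sup>2 - 1)) *\<^sub>R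
         (sinh (f (t, w)) *\<^sub>R F2 s + (g (t, w) * cosh (f (t, w))) *\<^sub>R F3 s
          - (cosh (f (t, w)) / (2 * g (t, w))) *\<^sub>R F4 s) :: real^4)"

definition canal5 where
  "canal5 \<gamma> F1 F2 F3 F4 (r :: real \<Rightarrow> real) \<epsilon> f g = (\<lambda>(s, t, w).
     \<gamma> s + (r s * deriv r s) *\<^sub>R F1 s
       + (\<epsilon> * r s * sqrt (1 + (deriv r s)\<^sup>2)) *\<^sub>R
         (sinh (f (t, w)) *\<^sub>R F2 s + (g (t, w) * cosh (f (t, w))) *\<^sub>R F3 s
          - (cosh (f (t, w)) / (2 * g (t, w))) *\<^sub>R F4 s) :: real^4)"

definition admissible :: "(real \<times> real) set \<Rightarrow> (real \<times> real \<Rightarrow> real) \<Rightarrow> (real \<times> real \<Rightarrow> real) \<Rightarrow> bool" where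
  "admissible V f g \<longleftrightarrow> open V \<and> smooth_on V f \<and> smooth_on V g \<and> (\<forall>q\<in>V. g q \<noteq> 0)"

(* The point set M is the image of a regular parametrization from the family Y, for some
   choice of the functions f and g. For X - \<gamma> = a1 F1 + a2 F2 + a3 F3 + a4 F4 the products of F3 and
   F4 give a3 = <X - \<gamma>, F4> and a4 = <X - \<gamma>, F3>. Around points where a3 * a4 vanishes neither
   canal1, canal2 nor canal3 is such a parametrization: they only have a3 * a4 >= 0 resp. <= 0, and
   none of them meets a point where exactly one of a3, a4 is 0. *)

definition parametrized_by ::
  "real set \<Rightarrow> ((real \<times> real \<Rightarrow> real) \<Rightarrow> (real \<times> real \<Rightarrow> real) \<Rightarrow> real \<times> real \<times> real \<Rightarrow> real^4) \<Rightarrow>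
   (real^4) set \<Rightarrow> bool" where
  "parametrized_by I Y M \<longleftrightarrow>
     (\<exists>V f g W. admissible V f g \<and> open W \<and> W \<subseteq> I \<times> V \<and>
        (\<forall>p\<in>W. regular_at (Y f g) p) \<and> Y f g ` W = M)"

end

theory Submission
  imports Defs
begin

text \<open>
Write \<open>R = X - \<gamma>\<close> for a hypersurface \<open>X\<close> with
\<open>\<langle>R, R\<rangle> = l r\<^sup>2\<close>, where \<open>l = 1\<close> for pseudo
hyperspheres and \<open>l = -1\<close> for pseudo hyperbolic ones. Differentiating this relation shows
that \<open>R\<close> is normal to \<open>X\<close> exactly when
\<open>\<langle>R, F1\<rangle> = - l r r'\<close> (\<open>radial_derivative\<close>). So an
envelope is described by two scalar equations in the frame coordinates
\<open>R = a1 F1 + a2 F2 + a3 F3 + a4 F4\<close>: \<open>a1 = - l r r'\<close> and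
\<open>a2\<^sup>2 + 2 a3 a4 = l r\<^sup>2 - r\<^sup>2 r'\<^sup>2\<close>.

For fixed \<open>s\<close> the second equation is a quadric surface in the coordinates
\<open>(a2, a3, a4)\<close>, and \<open>C1\<close>, ..., \<open>C5\<close> parametrize parts of it
in one and the same shape: \<open>b (A f, g B f, \<delta> B f / (2 g))\<close>, where
\<open>A\<^sup>2 + \<delta> B\<^sup>2 = \<tau>\<close> is a circle or a branch of a hyperbola
(\<open>frame_canal\<close>). When \<open>b\<close> is such that \<open>\<tau> b\<^sup>2\<close> is the
right hand side, this map satisfies both equations whatever \<open>f\<close> and \<open>g\<close> are,
hence is an envelope. Its normal line at a regular point is spanned by
\<open>R\<close>, whose square \<open>l r\<^sup>2\<close> has the sign of \<open>l\<close>; this decides between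
timelike and spacelike (\<open>unit_normals_causal_character\<close>).

Conversely, let \<open>X\<close> be a regular envelope. Where \<open>a3\<close> does not vanish and
\<open>a2 / b\<close> lies in the range of \<open>A\<close>, one can solve for \<open>f\<close> and
\<open>g\<close>. This gives a differentiable map \<open>\<Psi>\<close> of parameters with
\<open>X = Y \<circ> \<Psi>\<close>, where \<open>Y\<close> is the canal map built from the two
coordinate functions \<open>f (t, w) = t\<close> and \<open>g (t, w) = w\<close>. Since the derivative of
\<open>X\<close> is injective, that of \<open>\<Psi>\<close> is invertible, so the image of
\<open>\<Psi>\<close> is open, \<open>Y\<close> is regular on it and traces the same point set as
\<open>X\<close> (\<open>parametrized_by_frame_canal\<close>). If the right hand side of the second equation
is negative, \<open>a3\<close> never vanishes and the hyperbola with \<open>A = sinh\<close> covers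
everything. If it is positive, points with \<open>a3 a4 > 0\<close> are reached by the circle and those
with \<open>a3 a4 < 0\<close> by the branch of the hyperbola \<open>A = cosh\<close> chosen by the sign of
\<open>a2\<close>. The remaining set \<open>a3 a4 = 0\<close> has no interior, because where
\<open>a3\<close> or \<open>a4\<close> vanishes identically the quadric degenerates to lines and
\<open>X\<close> would have rank at most two (\<open>null_coordinate_not_locally_zero\<close>).
\<close>

section \<open>Calculus of smooth maps\<close>

lemma frechet_derivative_eq:
  "(f has_derivative f') (at x) \<Longrightarrow> frechet_derivative f (at x) = f'"
  using frechet_derivative_at by metis

text \<open>A function is differentiated at the points of \<open>S\<close> within the whole space, so changing it
  outside \<open>S\<close> is harmless only because \<open>S\<close> is open.\<close>

lemma Ck_on_cong:
  assumes "open S" "\<And>x. x \<in> S \<Longrightarrow> f x = g x"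
  shows "Ck_on k S f \<longleftrightarrow> Ck_on k S g"
  using assms(2)
proof (induction k arbitrary: f g)
  case 0
  then show ?case by (simp cong: continuous_on_cong)
next
  case (Suc k)
  have hd: "(f has_derivative D) (at x) \<longleftrightarrow> (g has_derivative D) (at x)" if "x \<in> S" for x D
    using has_derivative_transform_within_open[OF _ assms(1) that, of f D UNIV g]
      has_derivative_transform_within_open[OF _ assms(1) that, of g D UNIV f] Suc.prems by auto
  then have df: "f differentiable (at x) \<longleftrightarrow> g differentiable (at x)" if "x \<in> S" for x
    using that by (simp add: differentiable_def)
  have "frechet_derivative f (at x) = frechet_derivative g (at x)" if "x \<in> S" for x
    using hd[OF that] by (simp add: frechet_derivative_def)
  then have "Ck_on k S (\<lambda>x. frechet_derivative f (at x) v) \<longleftrightarrow>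
      Ck_on k S (\<lambda>x. frechet_derivative g (at x) v)" for v
    by (intro Suc.IH) simp
  with df show ?case by simp
qed

text \<open>The way in which smoothness is established below: any known derivative may stand for the
  chosen \<open>frechet_derivative\<close>.\<close>

lemma Ck_on_SucI:
  assumes "open S" "\<And>x. x \<in> S \<Longrightarrow> (f has_derivative f' x) (at x)"
    and "\<And>v. Ck_on k S (\<lambda>x. f' x v)"
  shows "Ck_on (Suc k) S f"
proof -
  have "Ck_on k S (\<lambda>x. frechet_derivative f (at x) v)" for v
    using Ck_on_cong[OF assms(1), of "\<lambda>x. frechet_derivative f (at x) v" "\<lambda>x. f' x v" k]
      frechet_derivative_eq[OF assms(2)] assms(3) by simp
  then show ?thesis using assms(2) by (auto simp: differentiable_def)
qed

lemma Ck_on_Suc_has_derivative: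
  assumes "Ck_on (Suc k) S f" "x \<in> S"
  shows "(f has_derivative frechet_derivative f (at x)) (at x)"
  using assms by (simp flip: frechet_derivative_works)

lemma Ck_on_lower: "Ck_on (Suc k) S f \<Longrightarrow> Ck_on k S f"
proof (induction k arbitrary: f)
  case 0
  then show ?case
    by (simp add: continuous_at_imp_continuous_on differentiable_imp_continuous_within)
next
  case (Suc k)
  from Suc.prems have "Ck_on (Suc k) S (\<lambda>x. frechet_derivative f (at x) v)" for v by simp
  then have "Ck_on k S (\<lambda>x. frechet_derivative f (at x) v)" for v by (rule Suc.IH)
  with Suc.prems show ?case by simp
qed

lemma Ck_on_const: "open S \<Longrightarrow> Ck_on k S (\<lambda>x. c)"
proof (induction k arbitrary: c)
  case 0
  then show ?case by simp
next
  case (Suc k)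
  then show ?case by (intro Ck_on_SucI[where f' = "\<lambda>_ _. 0"]) auto
qed

lemma Ck_on_bounded_linear: "open S \<Longrightarrow> bounded_linear L \<Longrightarrow> Ck_on k S L"
proof (cases k)
  case 0
  then show "bounded_linear L \<Longrightarrow> ?thesis" by (simp add: linear_continuous_on)
next
  case (Suc m)
  assume "open S" "bounded_linear L"
  then show ?thesis unfolding Suc
    by (intro Ck_on_SucI[where f' = "\<lambda>_. L"] bounded_linear_imp_has_derivative Ck_on_const)
qed

lemma Ck_on_add:
  assumes "open S"
  shows "Ck_on k S f \<Longrightarrow> Ck_on k S g \<Longrightarrow> Ck_on k S (\<lambda>x. f x + g x)"
proof (induction k arbitrary: f g)
  case 0
  then show ?case by (simp add: continuous_on_add)
next
  case (Suc k)
  show ?case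
  proof (rule Ck_on_SucI[OF assms])
    show "((\<lambda>x. f x + g x) has_derivative
        (\<lambda>v. frechet_derivative f (at x) v + frechet_derivative g (at x) v)) (at x)" if "x \<in> S" for x
      using Suc.prems[THEN Ck_on_Suc_has_derivative, OF that] by (rule has_derivative_add)
    show "Ck_on k S (\<lambda>x. frechet_derivative f (at x) v + frechet_derivative g (at x) v)" for v
      using Suc.prems by (intro Suc.IH) auto
  qed
qed

lemma Ck_on_sum:
  assumes "open S" "\<And>i. i \<in> A \<Longrightarrow> Ck_on k S (f i)"
  shows "Ck_on k S (\<lambda>x. \<Sum>i\<in>A. f i x)"
  using assms(2)
  by (induction A rule: infinite_finite_induct) (simp_all add: assms(1) Ck_on_const Ck_on_add)

lemma (in bounded_bilinear) Ck_on_prod: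
  assumes "open S"
  shows "Ck_on k S f \<Longrightarrow> Ck_on k S g \<Longrightarrow> Ck_on k S (\<lambda>x. prod (f x) (g x))"
proof (induction k arbitrary: f g)
  case 0
  then show ?case by (simp add: continuous_on)
next
  case (Suc k)
  show ?case
  proof (rule Ck_on_SucI[OF assms])
    show "((\<lambda>x. prod (f x) (g x)) has_derivative (\<lambda>v. prod (f x) (frechet_derivative g (at x) v)
        + prod (frechet_derivative f (at x) v) (g x))) (at x)" if "x \<in> S" for x
      using Suc.prems[THEN Ck_on_Suc_has_derivative, OF that] by (rule FDERIV)
    show "Ck_on k S (\<lambda>x. prod (f x) (frechet_derivative g (at x) v)
        + prod (frechet_derivative f (at x) v) (g x))" for v
      using Suc.prems Suc.prems[THEN Ck_on_lower] by (intro Ck_on_add[OF assms] Suc.IH) auto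
  qed
qed

text \<open>The chain rule differentiates \<open>h \<circ> u\<close> into
  \<open>Dh (u x) (Du x v)\<close>, in which the direction fed to \<open>Dh\<close> varies with
  \<open>x\<close>. Expanding that direction in the standard basis leaves compositions of the partial
  derivatives of \<open>h\<close> with \<open>u\<close>, to which the induction hypothesis applies.\<close>

lemma Ck_on_compose:
  fixes h :: "'b::euclidean_space \<Rightarrow> 'c::real_normed_vector"
  assumes "open S" "open T" "u ` S \<subseteq> T"
  shows "Ck_on k T h \<Longrightarrow> Ck_on k S u \<Longrightarrow> Ck_on k S (\<lambda>x. h (u x))"
proof (induction k arbitrary: h)
  case 0
  then show ?case using assms(3) by (auto intro: continuous_on_compose2)
next
  case (Suc k)
  let ?D = "\<lambda>y. frechet_derivative h (at y)" and ?E = "\<lambda>x. frechet_derivative u (at x)"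
  show ?case
  proof (rule Ck_on_SucI[OF assms(1)])
    fix x assume x: "x \<in> S"
    then have "u x \<in> T" using assms(3) by auto
    note hD = Ck_on_Suc_has_derivative[OF Suc.prems(1) this]
    have "((\<lambda>x. h (u x)) has_derivative (\<lambda>v. ?D (u x) (?E x v))) (at x)"
      using Ck_on_Suc_has_derivative[OF Suc.prems(2) x] hD by (rule has_derivative_compose)
    moreover have "?D (u x) (?E x v) = (\<Sum>b\<in>Basis. (?E x v \<bullet> b) *\<^sub>R ?D (u x) b)" for v
      using has_derivative_linear[OF hD]
      by (subst euclidean_representation[of "?E x v", symmetric])
        (simp add: linear_sum linear_scale del: euclidean_representation)
    ultimately show "((\<lambda>x. h (u x)) has_derivative
        (\<lambda>v. \<Sum>b\<in>Basis. (?E x v \<bullet> b) *\<^sub>R ?D (u x) b)) (at x)" by simp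
  next
    fix v
    have "Ck_on k S (\<lambda>x. ?E x v \<bullet> b)" for b
      using Suc.prems(2)
      by (intro bounded_bilinear.Ck_on_prod[OF bounded_bilinear_inner assms(1)]
          Ck_on_const[OF assms(1)]) auto
    moreover have "Ck_on k S (\<lambda>x. ?D (u x) b)" for b
      using Suc.prems Suc.prems(2)[THEN Ck_on_lower] by (intro Suc.IH) auto
    ultimately show "Ck_on k S (\<lambda>x. \<Sum>b\<in>Basis. (?E x v \<bullet> b) *\<^sub>R ?D (u x) b)"
      by (intro Ck_on_sum[OF assms(1)] assms(1)
          bounded_bilinear.Ck_on_prod[OF bounded_bilinear_scaleR])
  qed
qed

lemma smooth_on_has_derivative:
  "smooth_on S f \<Longrightarrow> x \<in> S \<Longrightarrow> (f has_derivative frechet_derivative f (at x)) (at x)"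
  unfolding smooth_on_def using Ck_on_Suc_has_derivative by blast

lemma smooth_on_differentiable: "smooth_on S f \<Longrightarrow> x \<in> S \<Longrightarrow> f differentiable (at x)"
  using smooth_on_has_derivative unfolding differentiable_def by blast

lemma smooth_on_const: "open S \<Longrightarrow> smooth_on S (\<lambda>x. c)"
  by (simp add: smooth_on_def Ck_on_const)

lemma smooth_on_bounded_linear: "open S \<Longrightarrow> bounded_linear L \<Longrightarrow> smooth_on S L"
  by (simp add: smooth_on_def Ck_on_bounded_linear)

lemma smooth_on_compose:
  assumes "smooth_on T h" "smooth_on S u" "open S" "open T" "\<And>x. x \<in> S \<Longrightarrow> u x \<in> T"
  shows "smooth_on S (\<lambda>x. h (u x))"
  using assms Ck_on_compose[of S T u] unfolding smooth_on_def by (metis image_subsetI)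

lemma smooth_on_add:
  "open S \<Longrightarrow> smooth_on S f \<Longrightarrow> smooth_on S g \<Longrightarrow> smooth_on S (\<lambda>x. f x + g x)"
  by (simp add: smooth_on_def Ck_on_add)

lemma smooth_on_scaleR:
  "open S \<Longrightarrow> smooth_on S f \<Longrightarrow> smooth_on S g \<Longrightarrow> smooth_on S (\<lambda>x. f x *\<^sub>R g x)"
  by (simp add: smooth_on_def bounded_bilinear.Ck_on_prod[OF bounded_bilinear_scaleR])

lemma smooth_on_mult:
  fixes f g :: "_ \<Rightarrow> real"
  shows "open S \<Longrightarrow> smooth_on S f \<Longrightarrow> smooth_on S g \<Longrightarrow> smooth_on S (\<lambda>x. f x * g x)"
  by (simp add: smooth_on_def bounded_bilinear.Ck_on_prod[OF bounded_bilinear_mult])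

lemma smooth_on_minus:
  fixes f :: "_ \<Rightarrow> real"
  assumes "open S" "smooth_on S f"
  shows "smooth_on S (\<lambda>x. - f x)"
  using smooth_on_mult[OF assms(1) smooth_on_const[OF assms(1), of "-1"] assms(2)] by simp

lemma smooth_on_diff:
  fixes f g :: "_ \<Rightarrow> real"
  shows "open S \<Longrightarrow> smooth_on S f \<Longrightarrow> smooth_on S g \<Longrightarrow> smooth_on S (\<lambda>x. f x - g x)"
  using smooth_on_add[OF _ _ smooth_on_minus, of S f g] by simp

lemma Ck_on_SucI_real:
  fixes f :: "real \<Rightarrow> real"
  assumes "open S" "\<And>x. x \<in> S \<Longrightarrow> (f has_real_derivative f' x) (at x)" "Ck_on k S f'"
  shows "Ck_on (Suc k) S f"
proof (rule Ck_on_SucI[OF assms(1)])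
  show "(f has_derivative (\<lambda>v. f' x * v)) (at x)" if "x \<in> S" for x
    using assms(2)[OF that] by (simp add: has_field_derivative_def)
  show "Ck_on k S (\<lambda>x. f' x * v)" for v
    by (intro bounded_bilinear.Ck_on_prod[OF bounded_bilinear_mult] Ck_on_const assms)
qed

lemma smooth_on_deriv:
  fixes f :: "real \<Rightarrow> real"
  assumes "smooth_on S f" "open S"
  shows "smooth_on S (deriv f)"
  unfolding smooth_on_def
proof
  fix k
  have "frechet_derivative f (at x) 1 = deriv f x" if "x \<in> S" for x
    using smooth_on_differentiable[OF assms(1) that]
    by (metis DERIV_deriv_iff_real_differentiable frechet_derivative_eq
        has_field_derivative_imp_has_derivative mult.right_neutral)
  moreover have "Ck_on k S (\<lambda>x. frechet_derivative f (at x) 1)"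
    using assms(1) by (simp add: smooth_on_def flip: Ck_on.simps(2)) (metis Ck_on.simps(2))
  ultimately show "Ck_on k S (deriv f)"
    using Ck_on_cong[OF assms(2), of "\<lambda>x. frechet_derivative f (at x) 1" "deriv f" k] by simp
qed

lemma smooth_on_exp: "smooth_on UNIV (exp :: real \<Rightarrow> real)"
  unfolding smooth_on_def
proof
  show "Ck_on k UNIV (exp :: real \<Rightarrow> real)" for k
  proof (induction k)
    case (Suc k)
    then show ?case by (intro Ck_on_SucI_real[where f' = exp]) (auto intro: DERIV_exp)
  qed (simp add: continuous_on_exp)
qed

lemma smooth_on_sin_cos:
  "smooth_on UNIV (sin :: real \<Rightarrow> real)" "smooth_on UNIV (cos :: real \<Rightarrow> real)"
proof -
  have "Ck_on k UNIV (sin :: real \<Rightarrow> real) \<and> Ck_on k UNIV (cos :: real \<Rightarrow> real)" for k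
  proof (induction k)
    case (Suc k)
    have "Ck_on k UNIV (\<lambda>x::real. - 1 * sin x)"
      using Suc by (intro bounded_bilinear.Ck_on_prod[OF bounded_bilinear_mult] Ck_on_const) auto
    then show ?case using Suc
      by (auto intro!: Ck_on_SucI_real[where f = sin and f' = cos]
          Ck_on_SucI_real[where f = cos and f' = "\<lambda>x. - 1 * sin x"] derivative_eq_intros
          simp del: Ck_on.simps)
  qed (simp add: continuous_on_sin continuous_on_cos)
  then show "smooth_on UNIV (sin :: real \<Rightarrow> real)" "smooth_on UNIV (cos :: real \<Rightarrow> real)"
    by (simp_all add: smooth_on_def)
qed

lemma smooth_on_sinh_cosh:
  "smooth_on UNIV (sinh :: real \<Rightarrow> real)" "smooth_on UNIV (cosh :: real \<Rightarrow> real)"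
proof -
  have e: "smooth_on UNIV (\<lambda>x::real. exp (- x))"
    by (rule smooth_on_compose[OF smooth_on_exp])
      (auto intro!: smooth_on_bounded_linear bounded_linear_minus bounded_linear_ident)
  have "smooth_on UNIV (\<lambda>x::real. (1/2) * (exp x - exp (- x)))"
    "smooth_on UNIV (\<lambda>x::real. (1/2) * (exp x + exp (- x)))"
    by (intro smooth_on_mult smooth_on_diff smooth_on_add smooth_on_const e smooth_on_exp; simp)+
  moreover have "(\<lambda>x::real. (1/2) * (exp x - exp (- x))) = sinh"
    "(\<lambda>x::real. (1/2) * (exp x + exp (- x))) = cosh"
    by (auto simp: sinh_def cosh_def)
  ultimately show "smooth_on UNIV (sinh :: real \<Rightarrow> real)" "smooth_on UNIV (cosh :: real \<Rightarrow> real)"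
    by simp_all
qed

lemma smooth_on_inverse_real: "smooth_on (- {0}) (inverse :: real \<Rightarrow> real)"
proof -
  have "Ck_on k (- {0}) (inverse :: real \<Rightarrow> real)" for k
  proof (induction k)
    case (Suc k)
    show ?case
    proof (rule Ck_on_SucI_real)
      show "(inverse has_real_derivative (- 1 * (inverse x * inverse x))) (at x)"
        if "x \<in> - {0}" for x
        using that DERIV_inverse[of x] by (simp add: power2_eq_square)
      show "Ck_on k (- {0}) (\<lambda>x::real. - 1 * (inverse x * inverse x))"
        using Suc
        by (intro bounded_bilinear.Ck_on_prod[OF bounded_bilinear_mult] Ck_on_const) auto
    qed auto
  qed (auto intro!: continuous_intros)
  then show ?thesis by (simp add: smooth_on_def)
qed

lemma smooth_on_inverse:
  fixes f :: "_ \<Rightarrow> real"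
  assumes "open S" "smooth_on S f" "\<And>x. x \<in> S \<Longrightarrow> f x \<noteq> 0"
  shows "smooth_on S (\<lambda>x. inverse (f x))"
  by (rule smooth_on_compose[OF smooth_on_inverse_real assms(2,1)]) (use assms(3) in auto)

lemma smooth_on_divide:
  fixes f g :: "_ \<Rightarrow> real"
  assumes "open S" "smooth_on S f" "smooth_on S g" "\<And>x. x \<in> S \<Longrightarrow> g x \<noteq> 0"
  shows "smooth_on S (\<lambda>x. f x / g x)"
  unfolding divide_inverse using assms by (intro smooth_on_mult smooth_on_inverse) auto

lemma smooth_on_sqrt_real: "smooth_on {0<..} sqrt"
proof -
  have "Ck_on k {0<..} sqrt" for k
  proof (induction k)
    case (Suc k)
    show ?case
    proof (rule Ck_on_SucI_real)
      show "(sqrt has_real_derivative inverse (sqrt x) * (1/2)) (at x)" if "x \<in> {0<..}" for x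
        using that DERIV_real_sqrt[of x] by simp
      have "sqrt ` {0<..} \<subseteq> - {0}" by auto
      moreover have "Ck_on k (- {0}) (inverse :: real \<Rightarrow> real)"
        using smooth_on_inverse_real unfolding smooth_on_def by blast
      ultimately have "Ck_on k {0<..} (\<lambda>x. inverse (sqrt x))"
        using Suc Ck_on_compose[of "{0<..}" "- {0}" sqrt k inverse]
        by (simp add: open_Compl)
      then show "Ck_on k {0<..} (\<lambda>x. inverse (sqrt x) * (1/2))"
        by (intro bounded_bilinear.Ck_on_prod[OF bounded_bilinear_mult] Ck_on_const) auto
    qed auto
  qed (auto intro!: continuous_intros)
  then show ?thesis by (simp add: smooth_on_def)
qed

lemma smooth_on_sqrt:
  fixes f :: "_ \<Rightarrow> real"
  assumes "open S" "smooth_on S f" "\<And>x. x \<in> S \<Longrightarrow> f x > 0"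
  shows "smooth_on S (\<lambda>x. sqrt (f x))"
  by (rule smooth_on_compose[OF smooth_on_sqrt_real assms(2,1)]) (use assms(3) in auto)

section \<open>Hypersurfaces in Minkowski space\<close>

lemma bounded_bilinear_lorentz: "bounded_bilinear lorentz"
proof -
  have "bilinear lorentz"
    by (auto simp: bilinear_def lorentz_def linear_iff algebra_simps)
  then show ?thesis by (simp add: bilinear_conv_bounded_bilinear)
qed

interpretation lorentz: bounded_bilinear lorentz
  by (rule bounded_bilinear_lorentz)

lemmas lorentz_linear = lorentz.add_left lorentz.add_right lorentz.diff_left lorentz.diff_right
  lorentz.scaleR_left lorentz.scaleR_right lorentz.zero_left lorentz.zero_right
  lorentz.minus_left lorentz.minus_right

lemma lorentz_commute: "lorentz u v = lorentz v u"
  by (simp add: lorentz_def)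

lemma lorentz_nondegenerate:
  assumes "\<And>w. lorentz u w = 0"
  shows "u = 0"
proof -
  have "u $ i = 0" for i
    using assms[of "axis 1 1"] assms[of "axis 2 1"] assms[of "axis 3 1"] assms[of "axis 4 1"]
      exhaust_4[of i]
    by (auto simp: lorentz_def axis_def)
  then show ?thesis by (simp add: vec_eq_iff)
qed

lemma regular_at_linear:
  assumes "regular_at X p"
  shows "linear (frechet_derivative X (at p))"
  using assms unfolding regular_at_def by (blast intro: linear_frechet_derivative)

text \<open>A regular hypersurface of a four-dimensional space has a three-dimensional tangent space. A
  normal \<open>N\<close> that is not null lies outside it, so \<open>N\<close> and the tangent
  space span everything; the component of another normal that is orthogonal to \<open>N\<close> is then
  orthogonal to the whole space.\<close>

lemma normal_at_unique_up_to_scale: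
  assumes X: "regular_at X p" and N: "normal_at X p N" "lorentz N N \<noteq> 0"
    and M: "normal_at X p M"
  shows "M = (lorentz M N / lorentz N N) *\<^sub>R N"
proof -
  let ?D = "frechet_derivative X (at p)"
  define T :: "(real \<times> real \<times> real) \<times> real \<Rightarrow> real^4" where "T = (\<lambda>(v, c). ?D v + c *\<^sub>R N)"
  note lin = regular_at_linear[OF X]
  have "linear T"
    using lin by (auto simp: linear_iff T_def algebra_simps)
  moreover have "inj T"
  proof (rule linear_injective_0[OF \<open>linear T\<close>, THEN iffD2], intro allI impI)
    fix x assume "T x = 0"
    then obtain v c where x: "x = (v, c)" and vc: "?D v + c *\<^sub>R N = 0"
      by (cases x) (auto simp: T_def)
    from arg_cong[OF vc, of "lorentz N"] have "c = 0"
      using N unfolding normal_at_def by (simp add: lorentz_linear)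
    moreover from this have "v = 0"
      using vc X linear_injective_0[OF lin] unfolding regular_at_def by (metis add_0_right scale_zero_left)
    ultimately show "x = 0" using x by (simp add: zero_prod_def)
  qed
  ultimately have "dim (range T) = DIM(real^4)"
    using dim_image_eq[of T UNIV] by simp
  then have surj: "range T = UNIV"
    using dim_eq_full[of "range T"] \<open>linear T\<close> by (metis linear_subspace_image span_eq_iff subspace_UNIV)
  \<comment> \<open>the part of \<open>M\<close> orthogonal to \<open>N\<close>\<close>
  define R where "R = M - (lorentz M N / lorentz N N) *\<^sub>R N"
  have "lorentz N (?D v) = 0" "lorentz M (?D v) = 0" for v
    using N M unfolding normal_at_def by blast+
  then have "lorentz R (T x) = 0" for x
    using N(2) by (cases x) (simp add: T_def R_def lorentz_linear)
  then have "R = 0"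
    using surj by (intro lorentz_nondegenerate) (metis UNIV_I imageE)
  then show ?thesis by (simp add: R_def)
qed

text \<open>Every normal is a multiple of \<open>N\<close>, so its square is a positive multiple of
  \<open>l\<close>.\<close>

lemma unit_normals_causal_character:
  assumes "regular_at X p" "normal_at X p N" "lorentz N N = l * \<rho>\<^sup>2" "\<rho> > 0" "l = 1 \<or> l = -1"
  shows "(\<exists>M. unit_normal_at X p M) \<and> (\<forall>M. unit_normal_at X p M \<longrightarrow> lorentz M M = l)"
proof (intro conjI allI impI)
  have "unit_normal_at X p ((1 / \<rho>) *\<^sub>R N)"
    using assms by (auto simp: unit_normal_at_def normal_at_def lorentz_linear power2_eq_square)
  then show "\<exists>M. unit_normal_at X p M" ..
next
  fix M assume M: "unit_normal_at X p M"
  have "lorentz N N \<noteq> 0" using assms(3-5) by auto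
  then obtain c where c: "M = c *\<^sub>R N"
    using normal_at_unique_up_to_scale[OF assms(1,2)] M unfolding unit_normal_at_def by blast
  have "lorentz M M = l * (c * \<rho>)\<^sup>2"
    by (simp add: c lorentz_linear assms(3) power2_eq_square)
  moreover have "\<bar>lorentz M M\<bar> = 1" using M by (simp add: unit_normal_at_def)
  ultimately show "lorentz M M = l" using assms(5) by (auto simp: abs_mult)
qed

section \<open>The frame of a partially null curve\<close>

lemma has_derivative_fst_compose:
  fixes c :: "real \<Rightarrow> 'a::real_normed_vector" and p :: "real \<times> real \<times> real"
  assumes "(c has_vector_derivative c') (at (fst p))"
  shows "((\<lambda>q. c (fst q)) has_derivative (\<lambda>v. fst v *\<^sub>R c')) (at p)"
  using has_derivative_compose[OF bounded_linear_imp_has_derivative[OF bounded_linear_fst, of "at p"]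
      assms[unfolded has_vector_derivative_def]] .

context partially_null_curve
begin

lemma frame_products:
  assumes "s \<in> I"
  shows "lorentz (F1 s) (F1 s) = 1" "lorentz (F1 s) (F2 s) = 0" "lorentz (F1 s) (F3 s) = 0"
    "lorentz (F1 s) (F4 s) = 0" "lorentz (F2 s) (F1 s) = 0" "lorentz (F2 s) (F2 s) = 1"
    "lorentz (F2 s) (F3 s) = 0" "lorentz (F2 s) (F4 s) = 0" "lorentz (F3 s) (F1 s) = 0"
    "lorentz (F3 s) (F2 s) = 0" "lorentz (F3 s) (F3 s) = 0" "lorentz (F3 s) (F4 s) = 1"
    "lorentz (F4 s) (F1 s) = 0" "lorentz (F4 s) (F2 s) = 0" "lorentz (F4 s) (F3 s) = 1"
    "lorentz (F4 s) (F4 s) = 0"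
  using products_0 products_1 assms lorentz_commute by metis+

text \<open>The crossing of \<open>F3\<close> and \<open>F4\<close> in the expansion reflects that they are
  null and dual to each other.\<close>

lemma frame_expansion:
  assumes "s \<in> I"
  shows "u = lorentz u (F1 s) *\<^sub>R F1 s + lorentz u (F2 s) *\<^sub>R F2 s
           + lorentz u (F4 s) *\<^sub>R F3 s + lorentz u (F3 s) *\<^sub>R F4 s"
proof -
  define L :: "real^4 \<Rightarrow> real^4" where
    "L = (\<lambda>x. x$1 *\<^sub>R F1 s + x$2 *\<^sub>R F2 s + x$3 *\<^sub>R F3 s + x$4 *\<^sub>R F4 s)"
  have lin: "linear L" by (auto simp: linear_iff L_def algebra_simps)
  have coords: "lorentz (L x) (F1 s) = x$1" "lorentz (L x) (F2 s) = x$2"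
      "lorentz (L x) (F4 s) = x$3" "lorentz (L x) (F3 s) = x$4" for x
    by (simp_all add: L_def lorentz_linear frame_products[OF assms])
  have "inj L"
  proof (rule injI)
    fix x y assume "L x = L y"
    then have "x $ 1 = y $ 1" "x $ 2 = y $ 2" "x $ 3 = y $ 3" "x $ 4 = y $ 4"
      using coords[of x] coords[of y] by simp_all
    then show "x = y" by (simp add: vec_eq_iff forall_4)
  qed
  then have "surj L" using lin by (simp add: linear_injective_imp_surjective)
  then obtain x where "u = L x" by (metis surjD)
  then show ?thesis using coords[of x] by (simp add: L_def)
qed

lemma frame_expansion_square:
  assumes "s \<in> I"
  shows "lorentz u u = (lorentz u (F1 s))\<^sup>2 + (lorentz u (F2 s))\<^sup>2
           + 2 * lorentz u (F4 s) * lorentz u (F3 s)"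
proof -
  have "lorentz u (a *\<^sub>R F1 s + b *\<^sub>R F2 s + c *\<^sub>R F3 s + d *\<^sub>R F4 s)
      = a * lorentz u (F1 s) + b * lorentz u (F2 s) + c * lorentz u (F3 s) + d * lorentz u (F4 s)"
    for a b c d by (simp add: lorentz_linear)
  from trans[OF arg_cong[OF frame_expansion[OF assms, of u], of "lorentz u"] this]
  show ?thesis unfolding power2_eq_square by (simp add: mult.commute mult.left_commute)
qed

end

text \<open>If \<open>X\<close> moves on the spheres of radius \<open>r\<close> around \<open>\<gamma>\<close>, differentiating
  \<open>\<langle>X - \<gamma>, X - \<gamma>\<rangle> = l r\<^sup>2\<close> expresses all the products of
  \<open>X - \<gamma>\<close> with tangent vectors through the single product with \<open>\<gamma>'\<close>.
  Hence being an envelope amounts to one scalar equation, the value of the \<open>F1\<close>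
  coordinate of \<open>X - \<gamma>\<close>.\<close>

lemma (in partially_null_curve) radial_derivative:
  fixes X :: "real \<times> real \<times> real \<Rightarrow> real^4"
  assumes r: "r differentiable (at (fst p))"
    and U: "open U" "U \<subseteq> I \<times> UNIV" "p \<in> U" and X: "X differentiable (at p)"
    and sphere: "\<And>q. q \<in> U \<Longrightarrow> lorentz (X q - \<gamma> (fst q)) (X q - \<gamma> (fst q)) = l * (r (fst q))\<^sup>2"
  shows "lorentz (X p - \<gamma> (fst p)) (frechet_derivative X (at p) v)
    = (l * r (fst p) * deriv r (fst p) + lorentz (X p - \<gamma> (fst p)) (F1 (fst p))) * fst v"
proof -
  let ?D = "frechet_derivative X (at p)" and ?s = "fst p"
  have s: "?s \<in> I" using U by auto
  have D: "(X has_derivative ?D) (at p)" using X frechet_derivative_works by blast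
  have Y: "((\<lambda>q. X q - \<gamma> (fst q)) has_derivative (\<lambda>v. ?D v - fst v *\<^sub>R F1 ?s)) (at p)"
    by (rule has_derivative_diff[OF D has_derivative_fst_compose[OF frenet(1)[OF s]]])
  \<comment> \<open>two expressions for the derivative of the same function, to be compared\<close>
  have 1: "((\<lambda>q. lorentz (X q - \<gamma> (fst q)) (X q - \<gamma> (fst q))) has_derivative
     (\<lambda>v. lorentz (X p - \<gamma> ?s) (?D v - fst v *\<^sub>R F1 ?s) + lorentz (?D v - fst v *\<^sub>R F1 ?s) (X p - \<gamma> ?s))) (at p)"
    by (rule lorentz.FDERIV[OF Y Y])
  have comm: "lorentz (?D v - fst v *\<^sub>R F1 ?s) (X p - \<gamma> ?s)
      = lorentz (X p - \<gamma> ?s) (?D v - fst v *\<^sub>R F1 ?s)"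
    by (rule lorentz_commute)
  have "(r has_vector_derivative deriv r ?s) (at ?s)"
    using r by (simp add: DERIV_deriv_iff_real_differentiable has_real_derivative_iff_has_vector_derivative[symmetric])
  from has_derivative_fst_compose[OF this]
  have "((\<lambda>q. r (fst q)) has_derivative (\<lambda>v. fst v *\<^sub>R deriv r ?s)) (at p)" .
  then have "((\<lambda>q. l * (r (fst q))\<^sup>2) has_derivative (\<lambda>v. 2 * l * r ?s * deriv r ?s * fst v)) (at p)"
    by (auto intro!: derivative_eq_intros)
  then have 2: "((\<lambda>q. lorentz (X q - \<gamma> (fst q)) (X q - \<gamma> (fst q))) has_derivative
     (\<lambda>v. 2 * l * r ?s * deriv r ?s * fst v)) (at p)"
    by (rule has_derivative_transform_within_open[OF _ U(1,3)]) (simp add: sphere)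
  from fun_cong[OF has_derivative_unique[OF 1 2], of v]
  have "lorentz (X p - \<gamma> ?s) (?D v - fst v *\<^sub>R F1 ?s) = l * r ?s * deriv r ?s * fst v"
    unfolding comm by simp
  then show ?thesis
    by (simp add: lorentz.diff_right lorentz.scaleR_right algebra_simps)
qed

section \<open>The canal parametrizations\<close>

text \<open>The common shape of the canal parametrizations. The product of the coefficients of
  \<open>F3\<close> and \<open>F4\<close>, which is all that enters the square, is free of
  \<open>g\<close>; the pair \<open>(A, B)\<close> runs through a conic
  \<open>A\<^sup>2 + \<delta> B\<^sup>2 = const\<close>. The coefficient \<open>b\<close> contains
  the sign in front of the square root.\<close>

definition frame_canal :: "(real \<Rightarrow> real^4) \<Rightarrow> (real \<Rightarrow> real^4) \<Rightarrow> (real \<Rightarrow> real^4) \<Rightarrow> (real \<Rightarrow> real^4)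
    \<Rightarrow> (real \<Rightarrow> real^4) \<Rightarrow> (real \<Rightarrow> real) \<Rightarrow> (real \<Rightarrow> real) \<Rightarrow> (real \<Rightarrow> real) \<Rightarrow> (real \<Rightarrow> real) \<Rightarrow> real
    \<Rightarrow> (real \<times> real \<Rightarrow> real) \<Rightarrow> (real \<times> real \<Rightarrow> real) \<Rightarrow> real \<times> real \<times> real \<Rightarrow> real^4" where
  "frame_canal \<gamma> F1 F2 F3 F4 a b A B \<delta> f g = (\<lambda>p.
     \<gamma> (fst p) + a (fst p) *\<^sub>R F1 (fst p)
       + b (fst p) *\<^sub>R
         (A (f (snd p)) *\<^sub>R F2 (fst p) + (g (snd p) * B (f (snd p))) *\<^sub>R F3 (fst p)
          + (\<delta> * B (f (snd p)) / (2 * g (snd p))) *\<^sub>R F4 (fst p)))"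

lemma canal1_frame_canal:
  "canal1 \<gamma> F1 F2 F3 F4 r \<epsilon> = frame_canal \<gamma> F1 F2 F3 F4 (\<lambda>s. - (r s * deriv r s))
     (\<lambda>s. \<epsilon> * r s * sqrt (1 - (deriv r s)\<^sup>2)) sin cos 1"
  by (simp add: fun_eq_iff canal1_def frame_canal_def split: prod.split)

lemma canal3_frame_canal:
  "canal3 \<gamma> F1 F2 F3 F4 r \<epsilon> = frame_canal \<gamma> F1 F2 F3 F4 (\<lambda>s. - (r s * deriv r s))
     (\<lambda>s. \<epsilon> * r s * sqrt (1 - (deriv r s)\<^sup>2)) cosh sinh (-1)"
  by (simp add: fun_eq_iff canal3_def frame_canal_def split: prod.split)

lemma canal4_frame_canal:
  "canal4 \<gamma> F1 F2 F3 F4 r \<epsilon> = frame_canal \<gamma> F1 F2 F3 F4 (\<lambda>s. - (r s * deriv r s))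
     (\<lambda>s. \<epsilon> * r s * sqrt ((deriv r s)\<^sup>2 - 1)) sinh cosh (-1)"
  by (simp add: fun_eq_iff canal4_def frame_canal_def split: prod.split)

lemma canal5_frame_canal:
  "canal5 \<gamma> F1 F2 F3 F4 r \<epsilon> = frame_canal \<gamma> F1 F2 F3 F4 (\<lambda>s. r s * deriv r s)
     (\<lambda>s. \<epsilon> * r s * sqrt (1 + (deriv r s)\<^sup>2)) sinh cosh (-1)"
  by (simp add: fun_eq_iff canal5_def frame_canal_def split: prod.split)

text \<open>The substitution \<open>f \<mapsto> \<pi>/2 - f\<close> exchanges sine and cosine, so the second
  family consists of the same maps as the first.\<close>

lemma canal2_canal1:
  "canal2 \<gamma> F1 F2 F3 F4 r \<epsilon> f g = canal1 \<gamma> F1 F2 F3 F4 r \<epsilon> (\<lambda>q. pi / 2 - f q) g"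
  by (simp add: fun_eq_iff canal1_def canal2_def cos_diff sin_diff split: prod.split)

lemma admissible_quarter_turn:
  assumes "admissible V f g"
  shows "admissible V (\<lambda>q. pi / 2 - f q) g"
  using assms unfolding admissible_def by (auto intro!: smooth_on_diff smooth_on_const)

lemma parametrized_by_canal2:
  assumes "parametrized_by I (canal1 \<gamma> F1 F2 F3 F4 r \<epsilon>) M"
  shows "parametrized_by I (canal2 \<gamma> F1 F2 F3 F4 r \<epsilon>) M"
proof -
  from assms obtain V f g W where *: "admissible V f g" "open W" "W \<subseteq> I \<times> V"
      "\<forall>p\<in>W. regular_at (canal1 \<gamma> F1 F2 F3 F4 r \<epsilon> f g) p" "canal1 \<gamma> F1 F2 F3 F4 r \<epsilon> f g ` W = M"
    unfolding parametrized_by_def by blast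
  have "canal2 \<gamma> F1 F2 F3 F4 r \<epsilon> (\<lambda>q. pi / 2 - f q) g = canal1 \<gamma> F1 F2 F3 F4 r \<epsilon> f g"
    by (simp add: canal2_canal1)
  with * admissible_quarter_turn[OF *(1)] show ?thesis
    unfolding parametrized_by_def by metis
qed

context partially_null_curve
begin

lemma frame_canal_coordinates:
  fixes \<delta> :: real and p :: "real \<times> real \<times> real" and a b A B :: "real \<Rightarrow> real" and f g :: "real \<times> real \<Rightarrow> real"
  assumes "fst p \<in> I" "g (snd p) \<noteq> 0"
  defines "R \<equiv> frame_canal \<gamma> F1 F2 F3 F4 a b A B \<delta> f g p - \<gamma> (fst p)"
  shows "lorentz R (F1 (fst p)) = a (fst p)"
    and "lorentz R R = (a (fst p))\<^sup>2 + ((A (f (snd p)))\<^sup>2 + \<delta> * (B (f (snd p)))\<^sup>2) * (b (fst p))\<^sup>2"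
proof -
  show 1: "lorentz R (F1 (fst p)) = a (fst p)"
    by (simp add: R_def frame_canal_def lorentz_linear frame_products[OF assms(1)])
  have "lorentz R (F2 (fst p)) = b (fst p) * A (f (snd p))"
    "lorentz R (F4 (fst p)) = b (fst p) * (g (snd p) * B (f (snd p)))"
    "lorentz R (F3 (fst p)) = b (fst p) * (\<delta> * B (f (snd p)) / (2 * g (snd p)))"
    by (simp_all add: R_def frame_canal_def lorentz_linear frame_products[OF assms(1)])
  then show "lorentz R R = (a (fst p))\<^sup>2
      + ((A (f (snd p)))\<^sup>2 + \<delta> * (B (f (snd p)))\<^sup>2) * (b (fst p))\<^sup>2"
    using assms(2) unfolding frame_expansion_square[OF assms(1), of R] 1
    by (simp add: field_simps power2_eq_square)
qed

lemma smooth_on_frame_canal: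
  assumes "admissible V f g" "smooth_on I a" "smooth_on I b" "smooth_on UNIV A" "smooth_on UNIV B"
  shows "smooth_on (I \<times> V) (frame_canal \<gamma> F1 F2 F3 F4 a b A B \<delta> f g)"
proof -
  have V: "open V" "smooth_on V f" "smooth_on V g" "\<And>q. q \<in> V \<Longrightarrow> g q \<noteq> 0"
    using assms(1) by (auto simp: admissible_def)
  let ?O = "I \<times> V"
  have O: "open ?O" using interval V by (simp add: open_Times)
  have curve: "smooth_on ?O (\<lambda>p. c (fst p))" if "smooth_on I c" for c :: "real \<Rightarrow> 'z::real_normed_vector"
    by (rule smooth_on_compose[OF that smooth_on_bounded_linear[OF O bounded_linear_fst] O interval(1)]) auto
  have param: "smooth_on ?O (\<lambda>p. c (snd p))" if "smooth_on V c" for c :: "real \<times> real \<Rightarrow> real"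
    by (rule smooth_on_compose[OF that smooth_on_bounded_linear[OF O bounded_linear_snd] O V(1)]) auto
  have f: "smooth_on ?O (\<lambda>p. f (snd p))" and g: "smooth_on ?O (\<lambda>p. g (snd p))"
    using V param by auto
  have A: "smooth_on ?O (\<lambda>p. A (f (snd p)))" and B: "smooth_on ?O (\<lambda>p. B (f (snd p)))"
    by (rule smooth_on_compose[OF assms(4) f O open_UNIV UNIV_I])
      (rule smooth_on_compose[OF assms(5) f O open_UNIV UNIV_I])
  show ?thesis
    unfolding frame_canal_def
    by (intro smooth_on_add smooth_on_scaleR smooth_on_mult smooth_on_divide smooth_on_const
        curve smooth assms A B g O) (use V in auto)
qed

text \<open>The hypotheses on \<open>a\<close> and \<open>b\<close> are the two equations of an
  envelope: the first makes \<open>R\<close> normal, the second puts the point on the sphere.\<close>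

lemma frame_canal_is_envelope:
  fixes \<delta> l :: real and p :: "real \<times> real \<times> real" and a b A B :: "real \<Rightarrow> real" and f g :: "real \<times> real \<Rightarrow> real"
  assumes adm: "admissible V f g" and r: "smooth_on I r" "\<forall>s\<in>I. 0 < r s"
    and ab: "smooth_on I a" "smooth_on I b" "smooth_on UNIV A" "smooth_on UNIV B"
    and conic: "\<And>x. (A x)\<^sup>2 + \<delta> * (B x)\<^sup>2 = \<tau>"
    and a: "\<And>s. s \<in> I \<Longrightarrow> a s = - (l * r s * deriv r s)"
    and b: "\<And>s. s \<in> I \<Longrightarrow> (a s)\<^sup>2 + \<tau> * (b s)\<^sup>2 = l * (r s)\<^sup>2"
    and l: "l = 1 \<or> l = -1"
  defines "Y \<equiv> frame_canal \<gamma> F1 F2 F3 F4 a b A B \<delta> f g"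
  assumes p: "p \<in> I \<times> V"
  shows "lorentz (Y p - \<gamma> (fst p)) (Y p - \<gamma> (fst p)) = l * (r (fst p))\<^sup>2" (is ?sphere)
    and "normal_at Y p (Y p - \<gamma> (fst p))" (is ?normal)
    and "regular_at Y p \<Longrightarrow>
      (\<exists>N. unit_normal_at Y p N) \<and> (\<forall>N. unit_normal_at Y p N \<longrightarrow> lorentz N N = l)"
proof -
  have sphere: "lorentz (Y q - \<gamma> (fst q)) (Y q - \<gamma> (fst q)) = l * (r (fst q))\<^sup>2"
    and first: "lorentz (Y q - \<gamma> (fst q)) (F1 (fst q)) = a (fst q)" if "q \<in> I \<times> V" for q
    using that adm frame_canal_coordinates[of q g a b A B \<delta> f] b conic
    by (auto simp: Y_def admissible_def)
  show ?sphere by (rule sphere[OF p])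
  have O: "open (I \<times> V)" using interval adm by (simp add: open_Times admissible_def)
  have "smooth_on (I \<times> V) Y" unfolding Y_def by (rule smooth_on_frame_canal[OF adm ab])
  then have Y: "Y differentiable (at p)" using p by (rule smooth_on_differentiable)
  have s: "fst p \<in> I" using p by auto
  have "lorentz (Y p - \<gamma> (fst p)) (frechet_derivative Y (at p) v) = 0" for v
    using radial_derivative[OF smooth_on_differentiable[OF r(1) s] O _ p Y sphere, of v] first[OF p] a[OF s]
    by (simp add: Sigma_mono)
  then show normal: ?normal by (simp add: normal_at_def)
  show "(\<exists>N. unit_normal_at Y p N) \<and> (\<forall>N. unit_normal_at Y p N \<longrightarrow> lorentz N N = l)"
    if "regular_at Y p"
    by (rule unit_normals_causal_character[OF that normal sphere[OF p] _ l]) (use r(2) s in auto)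
qed

lemma envelope_first_coordinate:
  assumes r: "smooth_on I r" and U: "open U" "U \<subseteq> I \<times> UNIV" "p \<in> U" and X: "smooth_on U X"
    and sphere: "\<And>q. q \<in> U \<Longrightarrow> lorentz (X q - \<gamma> (fst q)) (X q - \<gamma> (fst q)) = l * (r (fst q))\<^sup>2"
    and normal: "normal_at X p (X p - \<gamma> (fst p))"
  shows "lorentz (X p - \<gamma> (fst p)) (F1 (fst p)) = - (l * r (fst p) * deriv r (fst p))"
proof -
  have s: "fst p \<in> I" using U by auto
  show ?thesis
    using radial_derivative[OF smooth_on_differentiable[OF r s] U smooth_on_differentiable[OF X U(3)] sphere,
        of "(1, 0, 0)"] normal
    by (simp add: normal_at_def)
qed

end

section \<open>Reparametrization of an envelope\<close>

text \<open>The derivative of \<open>X = Y \<circ> \<Psi>\<close> is injective, hence so is that of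
  \<open>\<Psi>\<close>; between spaces of equal dimension it is then invertible. Surjectivity makes
  the derivative of \<open>Y\<close> inherit injectivity, and a right inverse of the derivative makes
  \<open>\<Psi>\<close> open.\<close>

lemma reparametrization_regular_open:
  fixes X Y :: "real \<times> real \<times> real \<Rightarrow> real^4" and \<Psi> :: "real \<times> real \<times> real \<Rightarrow> real \<times> real \<times> real"
  assumes U: "open U" and X: "\<And>p. p \<in> U \<Longrightarrow> regular_at X p"
    and \<Psi>: "\<And>p. p \<in> U \<Longrightarrow> \<Psi> differentiable (at p)"
    and Y: "\<And>p. p \<in> U \<Longrightarrow> Y differentiable (at (\<Psi> p))"
    and eq: "\<And>p. p \<in> U \<Longrightarrow> Y (\<Psi> p) = X p"
  shows "open (\<Psi> ` U)" and "\<forall>q\<in>\<Psi> ` U. regular_at Y q"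
proof -
  have "regular_at Y (\<Psi> p) \<and> \<Psi> p \<in> interior (\<Psi> ` U)" if p: "p \<in> U" for p
  proof -
    let ?P = "frechet_derivative \<Psi> (at p)" and ?Y = "frechet_derivative Y (at (\<Psi> p))"
      and ?X = "frechet_derivative X (at p)"
    have P: "(\<Psi> has_derivative ?P) (at p)" and Q: "(Y has_derivative ?Y) (at (\<Psi> p))"
      using \<Psi>[OF p] Y[OF p] frechet_derivative_works by blast+
    have "(X has_derivative (\<lambda>v. ?Y (?P v))) (at p)"
      by (rule has_derivative_transform_within_open[OF has_derivative_compose[OF P Q] U p]) (rule eq)
    then have D: "?X = (\<lambda>v. ?Y (?P v))" by (rule frechet_derivative_eq)
    have "inj ?X" using X[OF p] by (simp add: regular_at_def)
    have lP: "linear ?P" using P by (rule has_derivative_linear)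
    have "inj ?P" using \<open>inj ?X\<close> unfolding D by (metis injD injI)
    then have "surj ?P" using lP by (simp add: linear_injective_imp_surjective)
    have "inj ?Y"
    proof (rule injI)
      fix x y assume "?Y x = ?Y y"
      moreover obtain x' y' where "x = ?P x'" "y = ?P y'" using \<open>surj ?P\<close> by (metis surjD)
      ultimately show "x = y" using \<open>inj ?X\<close> unfolding D by (metis injD)
    qed
    moreover obtain g where "linear g" "?P \<circ> g = id"
      using linear_surjective_right_inverse[OF lP \<open>surj ?P\<close>] by blast
    moreover have "continuous_on U \<Psi>"
      by (simp add: \<Psi> continuous_at_imp_continuous_on differentiable_imp_continuous_within)
    ultimately show ?thesis
      using sussmann_open_mapping[OF U _ p P, of g U] p U Y[OF p]
      by (simp add: regular_at_def linear_conv_bounded_linear interior_open)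
  qed
  then show "\<forall>q\<in>\<Psi> ` U. regular_at Y q" and "open (\<Psi> ` U)"
    using interior_subset[of "\<Psi> ` U"] by (auto simp flip: interior_eq)
qed

lemma differentiable_Pair:
  assumes "f differentiable (at x)" "g differentiable (at x)"
  shows "(\<lambda>y. (f y, g y)) differentiable (at x)"
  by (rule differentiableI[OF has_derivative_Pair[OF assms[unfolded frechet_derivative_works]]])

lemma lorentz_differentiable:
  assumes "f differentiable (at x)" "g differentiable (at x)"
  shows "(\<lambda>y. lorentz (f y) (g y)) differentiable (at x)"
  using assms lorentz.FDERIV unfolding differentiable_def by blast

context partially_null_curve
begin

lemma radial_coordinate_differentiable:
  fixes X :: "real \<times> real \<times> real \<Rightarrow> real^4"
  assumes "X differentiable (at p)" "fst p \<in> I" "smooth_on I c"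
  shows "(\<lambda>q. lorentz (X q - \<gamma> (fst q)) (c (fst q))) differentiable (at p)"
proof -
  have *: "(\<lambda>q::real \<times> real \<times> real. e (fst q)) differentiable (at p)" if "smooth_on I e"
    for e :: "real \<Rightarrow> real^4"
    using smooth_on_differentiable[OF that assms(2)]
    by (rule differentiable_compose[where f = e]) (auto intro: bounded_linear_imp_differentiable bounded_linear_fst)
  show ?thesis
    by (intro lorentz_differentiable differentiable_diff * assms smooth)
qed

text \<open>The local section \<open>h\<close> of \<open>A\<close> recovers \<open>f\<close> from
  the \<open>F2\<close> coordinate, and the \<open>F3\<close> coordinate then determines
  \<open>g\<close>. The \<open>F4\<close> coordinate comes out right because both sides satisfy
  the same quadratic equation, in which it occurs linearly with the nonzero factor
  \<open>\<langle>R, F4\<rangle>\<close>.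

  For a given \<open>X\<close> the recovered \<open>f\<close> and \<open>g\<close> depend on
  \<open>s\<close> too. They are therefore used as new parameters: the canal map is taken with the
  coordinate functions \<open>fst\<close> and \<open>snd\<close>, and the dependence goes into
  \<open>\<Psi>\<close>.\<close>

lemma parametrized_by_frame_canal:
  fixes X :: "real \<times> real \<times> real \<Rightarrow> real^4" and a b A B h :: "real \<Rightarrow> real" and \<delta> :: real
  assumes ab: "smooth_on I a" "smooth_on I b" "smooth_on UNIV A" "smooth_on UNIV B"
    and conic: "\<And>x. (A x)\<^sup>2 + \<delta> * (B x)\<^sup>2 = \<tau>"
    and b: "\<And>s. s \<in> I \<Longrightarrow> b s \<noteq> 0"
    and U: "open U" "U \<subseteq> I \<times> UNIV" and X: "\<And>p. p \<in> U \<Longrightarrow> regular_at X p"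
    and first: "\<And>p. p \<in> U \<Longrightarrow> lorentz (X p - \<gamma> (fst p)) (F1 (fst p)) = a (fst p)"
    and square: "\<And>p. p \<in> U \<Longrightarrow> lorentz (X p - \<gamma> (fst p)) (X p - \<gamma> (fst p))
        = (a (fst p))\<^sup>2 + \<tau> * (b (fst p))\<^sup>2"
    and third: "\<And>p. p \<in> U \<Longrightarrow> lorentz (X p - \<gamma> (fst p)) (F4 (fst p)) \<noteq> 0"
    and h: "\<And>p x. p \<in> U \<Longrightarrow> x = lorentz (X p - \<gamma> (fst p)) (F2 (fst p)) / b (fst p) \<Longrightarrow>
        h differentiable (at x) \<and> A (h x) = x \<and> B (h x) \<noteq> 0"
  shows "parametrized_by I (frame_canal \<gamma> F1 F2 F3 F4 a b A B \<delta>) (X ` U)"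
proof -
  \<comment> \<open>\<open>g = snd\<close> must not vanish\<close>
  define V :: "(real \<times> real) set" where "V = {q. snd q \<noteq> 0}"
  have "open V"
    unfolding V_def by (intro open_Collect_neq continuous_intros)
  then have adm: "admissible V fst snd"
    by (auto simp: admissible_def V_def intro: smooth_on_bounded_linear bounded_linear_fst bounded_linear_snd)
  let ?Y = "frame_canal \<gamma> F1 F2 F3 F4 a b A B \<delta> fst snd"
  define x where "x = (\<lambda>p. lorentz (X p - \<gamma> (fst p)) (F2 (fst p)) / b (fst p))"
  define y where "y = (\<lambda>p. lorentz (X p - \<gamma> (fst p)) (F4 (fst p)))"
  define \<Psi> where "\<Psi> = (\<lambda>p. (fst p, h (x p), y p / (b (fst p) * B (h (x p)))))"
  have props: "fst p \<in> I" "b (fst p) \<noteq> 0" "y p \<noteq> 0" "h differentiable (at (x p))"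
      "A (h (x p)) = x p" "B (h (x p)) \<noteq> 0" if "p \<in> U" for p
    using that U(2) b third[OF that] h[OF that refl] by (auto simp: x_def y_def)
  then have image: "\<Psi> ` U \<subseteq> I \<times> V" by (auto simp: \<Psi>_def V_def)
  have dX: "X differentiable (at p)" if "p \<in> U" for p
    using X[OF that] by (simp add: regular_at_def)
  have d\<Psi>: "\<Psi> differentiable (at p)" if p: "p \<in> U" for p
  proof -
    note pr = props[OF p]
    have dfst: "(fst :: real \<times> real \<times> real \<Rightarrow> real) differentiable (at p)"
      by (intro bounded_linear_imp_differentiable bounded_linear_fst)
    have db: "(\<lambda>q::real \<times> real \<times> real. b (fst q)) differentiable (at p)"
      using smooth_on_differentiable[OF ab(2) pr(1)] dfst
      by (rule differentiable_compose[where f = b])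
    have dx: "x differentiable (at p)"
      unfolding x_def
      by (intro differentiable_divide db radial_coordinate_differentiable dX[OF p] pr smooth)
    have dh: "(\<lambda>q. h (x q)) differentiable (at p)"
      using pr(4) dx by (rule differentiable_compose[where f = h])
    have dB: "(\<lambda>q. B (h (x q))) differentiable (at p)"
      using smooth_on_differentiable[OF ab(4) UNIV_I] dh
      by (rule differentiable_compose[where f = B])
    have dy: "y differentiable (at p)"
      unfolding y_def by (intro radial_coordinate_differentiable dX[OF p] pr smooth)
    have "(\<lambda>q. y q / (b (fst q) * B (h (x q)))) differentiable (at p)"
      using pr by (intro differentiable_divide dy differentiable_mult db dB) auto
    then show ?thesis
      unfolding \<Psi>_def by (intro differentiable_Pair dfst dh)
  qed
  have eq: "?Y (\<Psi> p) = X p" if p: "p \<in> U" for p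
  proof -
    note pr = props[OF p]
    let ?R = "X p - \<gamma> (fst p)" and ?b = "b (fst p)" and ?A = "A (h (x p))" and ?B = "B (h (x p))"
    let ?z = "lorentz ?R (F3 (fst p))" and ?g = "y p / (b (fst p) * B (h (x p)))"
    have 2: "lorentz ?R (F2 (fst p)) = ?b * ?A" using pr by (simp add: x_def)
    have "(a (fst p))\<^sup>2 + \<tau> * ?b\<^sup>2 = (a (fst p))\<^sup>2 + (?b * ?A)\<^sup>2 + 2 * y p * ?z"
      using square[OF p] frame_expansion_square[OF pr(1), of ?R] first[OF p] 2 by (simp add: y_def)
    then have "2 * y p * ?z = \<delta> * ?B\<^sup>2 * ?b\<^sup>2"
      unfolding conic[of "h (x p)", symmetric] by (simp add: algebra_simps power_mult_distrib)
    then have z: "?b * (\<delta> * ?B / (2 * ?g)) = ?z" and "?b * (?g * ?B) = y p"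
      using pr by (simp_all add: field_simps power2_eq_square)
    moreover have "?R = a (fst p) *\<^sub>R F1 (fst p) + (?b * ?A) *\<^sub>R F2 (fst p)
        + y p *\<^sub>R F3 (fst p) + ?z *\<^sub>R F4 (fst p)"
      using frame_expansion[OF pr(1), of ?R] unfolding first[OF p] 2 y_def .
    ultimately have "?R = a (fst p) *\<^sub>R F1 (fst p) + (?b * ?A) *\<^sub>R F2 (fst p)
        + (?b * (?g * ?B)) *\<^sub>R F3 (fst p) + (?b * (\<delta> * ?B / (2 * ?g))) *\<^sub>R F4 (fst p)"
      by simp
    then have "X p = \<gamma> (fst p) + (a (fst p) *\<^sub>R F1 (fst p) + (?b * ?A) *\<^sub>R F2 (fst p)
        + (?b * (?g * ?B)) *\<^sub>R F3 (fst p) + (?b * (\<delta> * ?B / (2 * ?g))) *\<^sub>R F4 (fst p))"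
      by (simp only: diff_eq_eq add.commute)
    then show ?thesis
      by (simp only: frame_canal_def \<Psi>_def fst_conv snd_conv scaleR_add_right scaleR_scaleR add.assoc)
  qed
  have dY: "?Y differentiable (at (\<Psi> p))" if "p \<in> U" for p
    using smooth_on_differentiable[OF smooth_on_frame_canal[OF adm ab]] image that by blast
  note rep = reparametrization_regular_open[where Y = ?Y, OF U(1) X d\<Psi> dY eq]
  have "?Y ` \<Psi> ` U = X ` U" unfolding image_image using eq by (rule image_cong[OF refl])
  with rep adm image show ?thesis unfolding parametrized_by_def by blast
qed

text \<open>Along directions \<open>v\<close> that keep \<open>s\<close> fixed, the curve and its frame do not
  move, so differentiating a coordinate of \<open>R\<close> yields that coordinate of the tangent
  vector. In particular a coordinate that depends on \<open>s\<close> alone contributes nothing.\<close>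

lemma slice_tangent_orthogonal:
  fixes X :: "real \<times> real \<times> real \<Rightarrow> real^4"
  assumes G: "open G" "p \<in> G" and X: "(X has_derivative D) (at p)" and s: "fst p \<in> I"
    and c: "smooth_on I c" and \<phi>: "\<phi> differentiable (at (fst p))"
    and eq: "\<And>q. q \<in> G \<Longrightarrow> lorentz (X q - \<gamma> (fst q)) (c (fst q)) = \<phi> (fst q)"
    and v: "fst v = 0"
  shows "lorentz (D v) (c (fst p)) = 0"
proof -
  have cd: "((\<lambda>q::real \<times> real \<times> real. c (fst q)) has_derivative
      (\<lambda>v. fst v *\<^sub>R vector_derivative c (at (fst p)))) (at p)"
    by (rule has_derivative_fst_compose)
      (use smooth_on_differentiable[OF c s] in \<open>simp add: vector_derivative_works\<close>)
  have \<phi>d: "((\<lambda>q::real \<times> real \<times> real. \<phi> (fst q)) has_derivative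
      (\<lambda>v. fst v *\<^sub>R vector_derivative \<phi> (at (fst p)))) (at p)"
    by (rule has_derivative_fst_compose) (use \<phi> in \<open>simp add: vector_derivative_works\<close>)
  have 1: "((\<lambda>q. lorentz (X q - \<gamma> (fst q)) (c (fst q))) has_derivative
      (\<lambda>v. lorentz (X p - \<gamma> (fst p)) (fst v *\<^sub>R vector_derivative c (at (fst p)))
        + lorentz (D v - fst v *\<^sub>R F1 (fst p)) (c (fst p)))) (at p)"
    by (rule lorentz.FDERIV[OF has_derivative_diff[OF X has_derivative_fst_compose[OF frenet(1)[OF s]]] cd])
  have 2: "((\<lambda>q. lorentz (X q - \<gamma> (fst q)) (c (fst q))) has_derivative
      (\<lambda>v. fst v *\<^sub>R vector_derivative \<phi> (at (fst p)))) (at p)"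
    by (rule has_derivative_transform_within_open[OF \<phi>d G]) (simp add: eq)
  from fun_cong[OF has_derivative_unique[OF 1 2], of v] v show ?thesis
    by (simp add: lorentz_linear)
qed

text \<open>The directions with fixed \<open>s\<close> form a plane, in which one linear condition still has
  a nonzero solution: choose \<open>v\<close> there with tangent vector orthogonal to \<open>M\<close>.
  That tangent vector is orthogonal to \<open>F1\<close> and \<open>N\<close> as well, because these
  coordinates of \<open>R\<close> depend on \<open>s\<close> alone near \<open>p\<close>, so it is a multiple
  of \<open>F2\<close>. Being orthogonal to \<open>R\<close>, which has a nonzero \<open>F2\<close>
  coordinate, it vanishes, against regularity.\<close>

lemma null_coordinate_not_locally_zero:
  fixes X :: "real \<times> real \<times> real \<Rightarrow> real^4"
  assumes NM: "N = F3 \<and> M = F4 \<or> N = F4 \<and> M = F3"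
    and G: "open G" "p \<in> G" and s: "fst p \<in> I" and X: "regular_at X p"
    and a: "smooth_on I a" "\<And>q. q \<in> G \<Longrightarrow> lorentz (X q - \<gamma> (fst q)) (F1 (fst q)) = a (fst q)"
    and normal: "normal_at X p (X p - \<gamma> (fst p))"
    and square: "lorentz (X p - \<gamma> (fst p)) (X p - \<gamma> (fst p)) \<noteq> (a (fst p))\<^sup>2"
    and zero: "\<And>q. q \<in> G \<Longrightarrow> lorentz (X q - \<gamma> (fst q)) (N (fst q)) = 0"
  shows False
proof -
  let ?D = "frechet_derivative X (at p)" and ?R = "X p - \<gamma> (fst p)" and ?s = "fst p"
  have D: "(X has_derivative ?D) (at p)"
    using X frechet_derivative_works by (auto simp: regular_at_def)
  note lin = regular_at_linear[OF X]
  have "smooth_on I N" using NM smooth by auto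
  obtain v where v: "fst v = 0" "v \<noteq> 0" "lorentz (?D v) (M ?s) = 0"
  proof -
    let ?m = "\<lambda>v. lorentz (?D v) (M ?s)"
    show thesis
    proof (cases "?m (0, 1, 0) = 0")
      case True
      then show ?thesis using that[of "(0, 1, 0)"] by (simp add: zero_prod_def)
    next
      case False
      have "(0, - ?m (0, 0, 1), ?m (0, 1, 0))
          = (- ?m (0, 0, 1)) *\<^sub>R (0, 1, 0) + ?m (0, 1, 0) *\<^sub>R (0::real, 0::real, 1::real)"
        by simp
      then have "?m (0, - ?m (0, 0, 1), ?m (0, 1, 0)) = 0"
        by (simp only: linear_add[OF lin] linear_scale[OF lin] lorentz_linear) simp
      then show ?thesis using False that[of "(0, - ?m (0, 0, 1), ?m (0, 1, 0))"]
        by (simp add: zero_prod_def)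
    qed
  qed
  have 1: "lorentz (?D v) (F1 ?s) = 0"
    by (rule slice_tangent_orthogonal[OF G D s smooth(2) smooth_on_differentiable[OF a(1) s] a(2) v(1)])
  have N: "lorentz (?D v) (N ?s) = 0"
    by (rule slice_tangent_orthogonal[OF G D s \<open>smooth_on I N\<close> _ _ v(1), of "\<lambda>_. 0"]) (use zero in auto)
  have 34: "lorentz (?D v) (F3 ?s) = 0" "lorentz (?D v) (F4 ?s) = 0"
    using N v(3) NM by auto
  have Dv: "?D v = lorentz (?D v) (F2 ?s) *\<^sub>R F2 ?s"
    using frame_expansion[OF s, of "?D v"] unfolding 1 34 by simp
  have "lorentz ?R (F3 ?s) = 0 \<or> lorentz ?R (F4 ?s) = 0" using zero[OF G(2)] NM by auto
  then have "lorentz ?R (F2 ?s) \<noteq> 0"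
    using square frame_expansion_square[OF s, of ?R] a(2)[OF G(2)] by auto
  moreover have "lorentz (?D v) (F2 ?s) * lorentz ?R (F2 ?s) = 0"
  proof -
    have "lorentz ?R (?D v) = 0" using normal unfolding normal_at_def by blast
    then show ?thesis using arg_cong[OF Dv, of "lorentz ?R"] by (simp add: lorentz.scaleR_right)
  qed
  ultimately have "?D v = 0" using Dv by auto
  then show False
    using v(2) X linear_injective_0[OF lin] unfolding regular_at_def by blast
qed

text \<open>On an open set where the product of the two null coordinates vanishes, one factor vanishes on
  a nonempty open subset: either the first factor is zero everywhere, or the second one is zero
  where the first is not.\<close>

lemma null_coordinates_nonzero_dense:
  fixes X :: "real \<times> real \<times> real \<Rightarrow> real^4"
  assumes U: "open U" "U \<subseteq> I \<times> UNIV" and X: "\<And>p. p \<in> U \<Longrightarrow> regular_at X p"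
    and a: "smooth_on I a" "\<And>q. q \<in> U \<Longrightarrow> lorentz (X q - \<gamma> (fst q)) (F1 (fst q)) = a (fst q)"
    and normal: "\<And>p. p \<in> U \<Longrightarrow> normal_at X p (X p - \<gamma> (fst p))"
    and square: "\<And>p. p \<in> U \<Longrightarrow> lorentz (X p - \<gamma> (fst p)) (X p - \<gamma> (fst p)) \<noteq> (a (fst p))\<^sup>2"
  shows "U \<subseteq> closure {p \<in> U. lorentz (X p - \<gamma> (fst p)) (F4 (fst p)) * lorentz (X p - \<gamma> (fst p)) (F3 (fst p)) \<noteq> 0}"
    (is "_ \<subseteq> closure ?C")
proof
  let ?y = "\<lambda>p. lorentz (X p - \<gamma> (fst p)) (F4 (fst p))" and ?z = "\<lambda>p. lorentz (X p - \<gamma> (fst p)) (F3 (fst p))"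
  fix p assume p: "p \<in> U"
  show "p \<in> closure ?C"
  proof (rule ccontr)
    assume "p \<notin> closure ?C"
    define G where "G = U - closure ?C"
    have G: "open G" "p \<in> G" "G \<subseteq> U"
      using U(1) p \<open>p \<notin> closure ?C\<close> by (auto simp: G_def open_Diff)
    have yz: "?y q = 0 \<or> ?z q = 0" if "q \<in> G" for q
      using that closure_subset[of ?C] by (auto simp: G_def)
    have cont: "continuous_on G ?y"
    proof (intro continuous_at_imp_continuous_on ballI differentiable_imp_continuous_within
        radial_coordinate_differentiable smooth)
      show "X differentiable (at q)" "fst q \<in> I" if "q \<in> G" for q
        using that G(3) U(2) X[of q] by (auto simp: regular_at_def)
    qed
    show False
    proof (cases "\<exists>q\<in>G. ?y q \<noteq> 0")
      case True
      then obtain q where q: "q \<in> G" "?y q \<noteq> 0" by blast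
      have op: "open {q \<in> G. ?y q \<noteq> 0}"
        using continuous_open_preimage[OF cont G(1), of "- {0}"] by (simp add: Int_def vimage_def open_Compl)
      have qU: "q \<in> U" and s: "fst q \<in> I" using q G U(2) by auto
      show False
        by (rule null_coordinate_not_locally_zero[OF _ op _ s, where N = F3 and M = F4 and X = X and a = a])
          (use q G yz X[OF qU] a normal[OF qU] square[OF qU] in auto)
    next
      case False
      have s: "fst p \<in> I" using p U(2) by auto
      show False
        by (rule null_coordinate_not_locally_zero[OF _ G(1,2) s, where N = F4 and M = F3 and X = X and a = a])
          (use p False G X[OF p] a normal[OF p] square[OF p] in auto)
    qed
  qed
qed

end

section \<open>The five families\<close>

lemma pseudo_hypersphere_iff:
  "u \<in> pseudo_hypersphere c \<rho> \<longleftrightarrow> lorentz (u - c) (u - c) = 1 * \<rho>\<^sup>2"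
  by (simp add: pseudo_hypersphere_def)

lemma pseudo_hyperbolic_hypersphere_iff:
  "u \<in> pseudo_hyperbolic_hypersphere c \<rho> \<longleftrightarrow> lorentz (u - c) (u - c) = (-1) * \<rho>\<^sup>2"
  by (simp add: pseudo_hyperbolic_hypersphere_def)

lemma cosh_sinh_conic: "(cosh x)\<^sup>2 + (-1) * (sinh x)\<^sup>2 = (1::real)"
  and sinh_cosh_conic: "(sinh x)\<^sup>2 + (-1) * (cosh x)\<^sup>2 = (-1::real)"
  by (simp_all add: cosh_square_eq)

text \<open>The three inverse functions below are the local sections of \<open>A\<close> that solve for
  \<open>f\<close>. The companion function \<open>B\<close> is nonzero on their values, which the
  formula for \<open>g\<close> divides by.\<close>

lemma arcsin_section:
  assumes "x\<^sup>2 < 1"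
  shows "arcsin differentiable (at x) \<and> sin (arcsin x) = x \<and> cos (arcsin x) \<noteq> 0"
proof -
  have "-1 < x" "x < 1" using assms by (auto simp: abs_square_less_1)
  then show ?thesis
    using DERIV_arcsin[of x] cos_arcsin_nonzero[of x] real_differentiable_def by auto
qed

lemma arcosh_section:
  fixes x :: real
  assumes "x > 1"
  shows "arcosh differentiable (at x) \<and> cosh (arcosh x) = x \<and> sinh (arcosh x) \<noteq> 0"
proof -
  have "(sinh (arcosh x))\<^sup>2 = x\<^sup>2 - 1" using assms by (simp add: sinh_square_eq)
  then have "sinh (arcosh x) \<noteq> 0" using assms by (auto simp: power2_eq_1_iff)
  then show ?thesis
    using assms arcosh_real_has_field_derivative[of x UNIV] real_differentiable_def by auto
qed

lemma arsinh_section: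
  fixes x :: real
  shows "arsinh differentiable (at x) \<and> sinh (arsinh x) = x \<and> cosh (arsinh x) \<noteq> 0"
  using arsinh_real_has_field_derivative[of x UNIV] real_differentiable_def cosh_real_pos[of "arsinh x"]
  by auto

context partially_null_curve
begin

lemma smooth_on_radius_coefficients:
  assumes "smooth_on I r" "\<forall>s\<in>I. 0 < r s"
  shows "smooth_on I (\<lambda>s. r s * deriv r s)" "smooth_on I (\<lambda>s. - (r s * deriv r s))"
    and "(\<And>s. s \<in> I \<Longrightarrow> (deriv r s)\<^sup>2 < 1) \<Longrightarrow> smooth_on I (\<lambda>s. \<epsilon> * r s * sqrt (1 - (deriv r s)\<^sup>2))"
    and "(\<And>s. s \<in> I \<Longrightarrow> (deriv r s)\<^sup>2 > 1) \<Longrightarrow> smooth_on I (\<lambda>s. \<epsilon> * r s * sqrt ((deriv r s)\<^sup>2 - 1))"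
    and "smooth_on I (\<lambda>s. \<epsilon> * r s * sqrt (1 + (deriv r s)\<^sup>2))"
  using interval(1) assms smooth_on_deriv[OF assms(1) interval(1)] unfolding power2_eq_square
  by (auto intro!: smooth_on_mult smooth_on_minus smooth_on_sqrt smooth_on_diff smooth_on_add
      smooth_on_const add_pos_nonneg)

text \<open>Both kinds of spheres are treated together, with \<open>l\<close> distinguishing them.\<close>

lemma envelope_facts:
  assumes r: "smooth_on I r" and env: "envelope_on I \<gamma> \<Sigma> U X"
    and \<Sigma>: "\<And>s u. u \<in> \<Sigma> s \<longleftrightarrow> lorentz (u - \<gamma> s) (u - \<gamma> s) = l * (r s)\<^sup>2"
  shows "open U" "U \<subseteq> I \<times> UNIV"
    and "\<And>p. p \<in> U \<Longrightarrow> lorentz (X p - \<gamma> (fst p)) (X p - \<gamma> (fst p)) = l * (r (fst p))\<^sup>2"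
    and "\<And>p. p \<in> U \<Longrightarrow> lorentz (X p - \<gamma> (fst p)) (F1 (fst p)) = - (l * r (fst p) * deriv r (fst p))"
    and "\<And>p. p \<in> U \<Longrightarrow> normal_at X p (X p - \<gamma> (fst p))"
proof -
  show U: "open U" "U \<subseteq> I \<times> UNIV"
    and sphere: "\<And>p. p \<in> U \<Longrightarrow> lorentz (X p - \<gamma> (fst p)) (X p - \<gamma> (fst p)) = l * (r (fst p))\<^sup>2"
    and normal: "\<And>p. p \<in> U \<Longrightarrow> normal_at X p (X p - \<gamma> (fst p))"
    using env \<Sigma> unfolding envelope_on_def by blast+
  have "smooth_on U X" using env by (simp add: envelope_on_def)
  then show "lorentz (X p - \<gamma> (fst p)) (F1 (fst p)) = - (l * r (fst p) * deriv r (fst p))"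
    if "p \<in> U" for p
    using envelope_first_coordinate[OF r U that _ sphere normal[OF that]] by blast
qed

lemma frame_canal_timelike_envelope:
  assumes adm: "admissible V f g" and r: "smooth_on I r" "\<forall>s\<in>I. 0 < r s"
    and a: "a = (\<lambda>s. - (r s * deriv r s))"
    and b: "smooth_on I b" "\<And>s. s \<in> I \<Longrightarrow> \<tau> * (b s)\<^sup>2 = (r s)\<^sup>2 * (1 - (deriv r s)\<^sup>2)"
    and AB: "smooth_on UNIV A" "smooth_on UNIV B" "\<And>x. (A x)\<^sup>2 + \<delta> * (B x)\<^sup>2 = \<tau>"
  shows "envelope_on I \<gamma> (\<lambda>s. pseudo_hypersphere (\<gamma> s) (r s)) (I \<times> V)
      (frame_canal \<gamma> F1 F2 F3 F4 a b A B \<delta> f g) \<and>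
    timelike_on (I \<times> V) (frame_canal \<gamma> F1 F2 F3 F4 a b A B \<delta> f g)"
proof -
  have sa: "smooth_on I a" unfolding a by (rule smooth_on_radius_coefficients[OF r])
  have sq: "(a s)\<^sup>2 + \<tau> * (b s)\<^sup>2 = 1 * (r s)\<^sup>2" if "s \<in> I" for s
    using b(2)[OF that] by (simp add: a power_mult_distrib algebra_simps)
  have a1: "a s = - (1 * r s * deriv r s)" for s by (simp add: a)
  note env = frame_canal_is_envelope[OF adm r sa b(1) AB a1 sq, simplified]
  have "open (I \<times> V)" using interval adm by (simp add: open_Times admissible_def)
  with smooth_on_frame_canal[OF adm sa b(1) AB(1,2)] env show ?thesis
    unfolding envelope_on_def timelike_on_def pseudo_hypersphere_iff by (simp add: Sigma_mono)
qed

lemma frame_canal_spacelike_envelope: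
  assumes adm: "admissible V f g" and r: "smooth_on I r" "\<forall>s\<in>I. 0 < r s"
    and a: "a = (\<lambda>s. r s * deriv r s)"
    and b: "smooth_on I b" "\<And>s. s \<in> I \<Longrightarrow> \<tau> * (b s)\<^sup>2 = - (r s)\<^sup>2 * (1 + (deriv r s)\<^sup>2)"
    and AB: "smooth_on UNIV A" "smooth_on UNIV B" "\<And>x. (A x)\<^sup>2 + \<delta> * (B x)\<^sup>2 = \<tau>"
  shows "envelope_on I \<gamma> (\<lambda>s. pseudo_hyperbolic_hypersphere (\<gamma> s) (r s)) (I \<times> V)
      (frame_canal \<gamma> F1 F2 F3 F4 a b A B \<delta> f g) \<and>
    spacelike_on (I \<times> V) (frame_canal \<gamma> F1 F2 F3 F4 a b A B \<delta> f g)"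
proof -
  have sa: "smooth_on I a" unfolding a by (rule smooth_on_radius_coefficients[OF r])
  have sq: "(a s)\<^sup>2 + \<tau> * (b s)\<^sup>2 = (-1) * (r s)\<^sup>2" if "s \<in> I" for s
    using b(2)[OF that] by (simp add: a power_mult_distrib algebra_simps)
  have a1: "a s = - ((-1) * r s * deriv r s)" for s by (simp add: a)
  note env = frame_canal_is_envelope[OF adm r sa b(1) AB a1 sq, simplified]
  have "open (I \<times> V)" using interval adm by (simp add: open_Times admissible_def)
  with smooth_on_frame_canal[OF adm sa b(1) AB(1,2)] env show ?thesis
    unfolding envelope_on_def spacelike_on_def pseudo_hyperbolic_hypersphere_iff by (simp add: Sigma_mono)
qed

lemma open_coordinate_condition:
  fixes X :: "real \<times> real \<times> real \<Rightarrow> real^4"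
  assumes U: "open U" "U \<subseteq> I \<times> UNIV" and X: "\<And>p. p \<in> U \<Longrightarrow> regular_at X p"
  defines "a2 \<equiv> \<lambda>p. lorentz (X p - \<gamma> (fst p)) (F2 (fst p))"
    and "a3 \<equiv> \<lambda>p. lorentz (X p - \<gamma> (fst p)) (F4 (fst p))"
    and "a4 \<equiv> \<lambda>p. lorentz (X p - \<gamma> (fst p)) (F3 (fst p))"
  shows "open {p \<in> U. a3 p * a4 p > 0}" "open {p \<in> U. a3 p * a4 p < 0 \<and> \<epsilon> * a2 p > 0}"
proof -
  have c: "continuous_on U (\<lambda>p. lorentz (X p - \<gamma> (fst p)) (F (fst p)))" if "smooth_on I F" for F
  proof (intro continuous_at_imp_continuous_on ballI differentiable_imp_continuous_within
      radial_coordinate_differentiable that)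
    show "X differentiable (at q)" "fst q \<in> I" if "q \<in> U" for q
      using that U(2) X[of q] by (auto simp: regular_at_def)
  qed
  have c2: "continuous_on U a2" and c3: "continuous_on U a3" and c4: "continuous_on U a4"
    unfolding a2_def a3_def a4_def by (rule c smooth)+
  have pre: "open {p \<in> U. 0 < k p}" if "continuous_on U k" for k :: "_ \<Rightarrow> real"
    using continuous_open_preimage[OF that U(1), of "{0<..}"] by (simp add: Int_def vimage_def)
  show "open {p \<in> U. a3 p * a4 p > 0}"
    by (intro pre continuous_on_mult c3 c4)
  have "open ({p \<in> U. 0 < - (a3 p * a4 p)} \<inter> {p \<in> U. 0 < \<epsilon> * a2 p})"
    by (intro open_Int pre continuous_on_minus continuous_on_mult continuous_on_const c2 c3 c4)
  moreover have "{p \<in> U. a3 p * a4 p < 0 \<and> \<epsilon> * a2 p > 0}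
      = {p \<in> U. 0 < - (a3 p * a4 p)} \<inter> {p \<in> U. 0 < \<epsilon> * a2 p}" by auto
  ultimately show "open {p \<in> U. a3 p * a4 p < 0 \<and> \<epsilon> * a2 p > 0}" by simp
qed

text \<open>By the quadratic equation, \<open>a3 a4 > 0\<close> says \<open>a2\<^sup>2 < b\<^sup>2\<close>, the open
  range of the sine.\<close>

lemma parametrized_by_sin_canal:
  fixes X :: "real \<times> real \<times> real \<Rightarrow> real^4"
  assumes ab: "smooth_on I a" "smooth_on I b" "\<And>s. s \<in> I \<Longrightarrow> b s \<noteq> 0"
    and U: "open U" "U \<subseteq> I \<times> UNIV" and X: "\<And>p. p \<in> U \<Longrightarrow> regular_at X p"
    and first: "\<And>p. p \<in> U \<Longrightarrow> lorentz (X p - \<gamma> (fst p)) (F1 (fst p)) = a (fst p)"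
    and square: "\<And>p. p \<in> U \<Longrightarrow> lorentz (X p - \<gamma> (fst p)) (X p - \<gamma> (fst p))
        = (a (fst p))\<^sup>2 + 1 * (b (fst p))\<^sup>2"
    and pos: "\<And>p. p \<in> U \<Longrightarrow>
        lorentz (X p - \<gamma> (fst p)) (F4 (fst p)) * lorentz (X p - \<gamma> (fst p)) (F3 (fst p)) > 0"
  shows "parametrized_by I (frame_canal \<gamma> F1 F2 F3 F4 a b sin cos 1) (X ` U)"
proof (rule parametrized_by_frame_canal[where h = arcsin,
      OF ab(1,2) smooth_on_sin_cos _ ab(3) U X first square])
  fix p x assume p: "p \<in> U" and x: "x = lorentz (X p - \<gamma> (fst p)) (F2 (fst p)) / b (fst p)"
  let ?R = "X p - \<gamma> (fst p)"
  have s: "fst p \<in> I" using p U(2) by auto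
  have "(lorentz ?R (F2 (fst p)))\<^sup>2 < (b (fst p))\<^sup>2"
    using frame_expansion_square[OF s, of ?R] square[OF p] first[OF p] pos[OF p] by (simp add: mult.commute)
  then have "x\<^sup>2 < 1" using ab(3)[OF s] by (simp add: x power_divide)
  then show "arcsin differentiable (at x) \<and> sin (arcsin x) = x \<and> cos (arcsin x) \<noteq> 0"
    by (rule arcsin_section)
next
  show "(sin x)\<^sup>2 + 1 * (cos x)\<^sup>2 = (1::real)" for x by simp
  show "lorentz (X p - \<gamma> (fst p)) (F4 (fst p)) \<noteq> 0" if "p \<in> U" for p
    using pos[OF that] by (metis less_irrefl mult_zero_left)
qed

text \<open>Here \<open>a3 a4 < 0\<close> says \<open>a2\<^sup>2 > b\<^sup>2\<close>. As the hyperbolic cosine is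
  positive, the sign of \<open>b\<close> has to match that of \<open>a2\<close>.\<close>

lemma parametrized_by_cosh_canal:
  fixes X :: "real \<times> real \<times> real \<Rightarrow> real^4"
  assumes ab: "smooth_on I a" "smooth_on I b" "\<And>s. s \<in> I \<Longrightarrow> b s \<noteq> 0"
    and U: "open U" "U \<subseteq> I \<times> UNIV" and X: "\<And>p. p \<in> U \<Longrightarrow> regular_at X p"
    and first: "\<And>p. p \<in> U \<Longrightarrow> lorentz (X p - \<gamma> (fst p)) (F1 (fst p)) = a (fst p)"
    and square: "\<And>p. p \<in> U \<Longrightarrow> lorentz (X p - \<gamma> (fst p)) (X p - \<gamma> (fst p))
        = (a (fst p))\<^sup>2 + 1 * (b (fst p))\<^sup>2"
    and neg: "\<And>p. p \<in> U \<Longrightarrow>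
        lorentz (X p - \<gamma> (fst p)) (F4 (fst p)) * lorentz (X p - \<gamma> (fst p)) (F3 (fst p)) < 0"
    and sheet: "\<And>p. p \<in> U \<Longrightarrow> lorentz (X p - \<gamma> (fst p)) (F2 (fst p)) / b (fst p) > 0"
  shows "parametrized_by I (frame_canal \<gamma> F1 F2 F3 F4 a b cosh sinh (-1)) (X ` U)"
proof (rule parametrized_by_frame_canal[where h = arcosh,
      OF ab(1,2) smooth_on_sinh_cosh(2,1) cosh_sinh_conic ab(3) U X first square])
  fix p x assume p: "p \<in> U" and x: "x = lorentz (X p - \<gamma> (fst p)) (F2 (fst p)) / b (fst p)"
  let ?R = "X p - \<gamma> (fst p)"
  have s: "fst p \<in> I" using p U(2) by auto
  have "(lorentz ?R (F2 (fst p)))\<^sup>2 > (b (fst p))\<^sup>2"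
    using frame_expansion_square[OF s, of ?R] square[OF p] first[OF p] neg[OF p] by (simp add: mult.commute)
  then have "1\<^sup>2 < x\<^sup>2" using ab(3)[OF s] by (simp add: x power_divide)
  moreover have "0 \<le> x" using sheet[OF p] x by simp
  ultimately have "1 < x" by (rule power2_less_imp_less)
  then show "arcosh differentiable (at x) \<and> cosh (arcosh x) = x \<and> sinh (arcosh x) \<noteq> 0"
    by (rule arcosh_section)
next
  show "lorentz (X p - \<gamma> (fst p)) (F4 (fst p)) \<noteq> 0" if "p \<in> U" for p
    using neg[OF that] by (metis less_irrefl mult_zero_left)
qed

text \<open>With \<open>a2\<^sup>2 + 2 a3 a4 = - b\<^sup>2 < 0\<close> the product \<open>a3 a4\<close> is
  never zero, and the hyperbolic sine takes all real values: one patch covers everything.\<close>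

lemma parametrized_by_sinh_canal:
  fixes X :: "real \<times> real \<times> real \<Rightarrow> real^4"
  assumes ab: "smooth_on I a" "smooth_on I b" "\<And>s. s \<in> I \<Longrightarrow> b s \<noteq> 0"
    and U: "open U" "U \<subseteq> I \<times> UNIV" and X: "\<And>p. p \<in> U \<Longrightarrow> regular_at X p"
    and first: "\<And>p. p \<in> U \<Longrightarrow> lorentz (X p - \<gamma> (fst p)) (F1 (fst p)) = a (fst p)"
    and square: "\<And>p. p \<in> U \<Longrightarrow> lorentz (X p - \<gamma> (fst p)) (X p - \<gamma> (fst p))
        = (a (fst p))\<^sup>2 + (-1) * (b (fst p))\<^sup>2"
  shows "parametrized_by I (frame_canal \<gamma> F1 F2 F3 F4 a b sinh cosh (-1)) (X ` U)"
proof (rule parametrized_by_frame_canal[where h = arsinh,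
      OF ab(1,2) smooth_on_sinh_cosh sinh_cosh_conic ab(3) U X first square])
  fix p assume p: "p \<in> U"
  let ?R = "X p - \<gamma> (fst p)"
  have s: "fst p \<in> I" using p U(2) by auto
  show "lorentz ?R (F4 (fst p)) \<noteq> 0"
  proof
    assume "lorentz ?R (F4 (fst p)) = 0"
    then have "lorentz ?R ?R = (a (fst p))\<^sup>2 + (lorentz ?R (F2 (fst p)))\<^sup>2"
      using frame_expansion_square[OF s, of ?R] first[OF p] by simp
    then have "(lorentz ?R (F2 (fst p)))\<^sup>2 + (b (fst p))\<^sup>2 = 0"
      using square[OF p] by linarith
    then show False using ab(3)[OF s] unfolding sum_power2_eq_zero_iff by blast
  qed
qed (assumption | rule arsinh_section)+

end

theorem theorem3:
  fixes I :: "real set"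
    and \<gamma> F1 F2 F3 F4 :: "real \<Rightarrow> real^4"
    and k1 k2 k3 r :: "real \<Rightarrow> real"
  assumes "partially_null_curve I \<gamma> F1 F2 F3 F4 k1 k2 k3"
    and "smooth_on I r"
    and "\<forall>s\<in>I. 0 < r s"
  shows
    "((\<forall>s\<in>I. (deriv r s)\<^sup>2 < 1) \<longrightarrow>
        (\<forall>\<epsilon>\<in>{-1, 1}.
           \<forall>Y\<in>{canal1 \<gamma> F1 F2 F3 F4 r \<epsilon>, canal2 \<gamma> F1 F2 F3 F4 r \<epsilon>, canal3 \<gamma> F1 F2 F3 F4 r \<epsilon>}.
           \<forall>V f g. admissible V f g \<longrightarrow>
             envelope_on I \<gamma> (\<lambda>s. pseudo_hypersphere (\<gamma> s) (r s)) (I \<times> V) (Y f g) \<and>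
             timelike_on (I \<times> V) (Y f g)) \<and>
        (\<forall>U X. envelope_on I \<gamma> (\<lambda>s. pseudo_hypersphere (\<gamma> s) (r s)) U X \<and>
               (\<forall>p\<in>U. regular_at X p) \<longrightarrow>
          (let a2 = (\<lambda>p. lorentz (X p - \<gamma> (fst p)) (F2 (fst p)));
               a3 = (\<lambda>p. lorentz (X p - \<gamma> (fst p)) (F4 (fst p)));
               a4 = (\<lambda>p. lorentz (X p - \<gamma> (fst p)) (F3 (fst p)))
           in U \<subseteq> closure {p\<in>U. a3 p * a4 p \<noteq> 0} \<and>
            (\<forall>\<epsilon>\<in>{-1, 1}.
             parametrized_by I (canal1 \<gamma> F1 F2 F3 F4 r \<epsilon>) (X ` {p\<in>U. a3 p * a4 p > 0}) \<and>
             parametrized_by I (canal2 \<gamma> F1 F2 F3 F4 r \<epsilon>) (X ` {p\<in>U. a3 p * a4 p > 0}) \<and>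
             parametrized_by I (canal3 \<gamma> F1 F2 F3 F4 r \<epsilon>)
               (X ` {p\<in>U. a3 p * a4 p < 0 \<and> \<epsilon> * a2 p > 0}))))) \<and>
     ((\<forall>s\<in>I. (deriv r s)\<^sup>2 > 1) \<longrightarrow>
        (\<forall>\<epsilon>\<in>{-1, 1}.
           (\<forall>V f g. admissible V f g \<longrightarrow>
             envelope_on I \<gamma> (\<lambda>s. pseudo_hypersphere (\<gamma> s) (r s)) (I \<times> V)
               (canal4 \<gamma> F1 F2 F3 F4 r \<epsilon> f g) \<and>
             timelike_on (I \<times> V) (canal4 \<gamma> F1 F2 F3 F4 r \<epsilon> f g)) \<and>
           (\<forall>U X. envelope_on I \<gamma> (\<lambda>s. pseudo_hypersphere (\<gamma> s) (r s)) U X \<and>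
                  (\<forall>p\<in>U. regular_at X p) \<longrightarrow>
             parametrized_by I (canal4 \<gamma> F1 F2 F3 F4 r \<epsilon>) (X ` U)))) \<and>
     (\<forall>\<epsilon>\<in>{-1, 1}.
        (\<forall>V f g. admissible V f g \<longrightarrow>
          envelope_on I \<gamma> (\<lambda>s. pseudo_hyperbolic_hypersphere (\<gamma> s) (r s)) (I \<times> V)
            (canal5 \<gamma> F1 F2 F3 F4 r \<epsilon> f g) \<and>
          spacelike_on (I \<times> V) (canal5 \<gamma> F1 F2 F3 F4 r \<epsilon> f g)) \<and>
        (\<forall>U X. envelope_on I \<gamma> (\<lambda>s. pseudo_hyperbolic_hypersphere (\<gamma> s) (r s)) U X \<and>
               (\<forall>p\<in>U. regular_at X p) \<longrightarrow>
          parametrized_by I (canal5 \<gamma> F1 F2 F3 F4 r \<epsilon>) (X ` U)))"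
    (is "(?small \<longrightarrow> ?C123 \<and> ?E123) \<and> (?large \<longrightarrow> ?C4) \<and> ?C5")
proof -
  interpret partially_null_curve I \<gamma> F1 F2 F3 F4 k1 k2 k3 by fact
  note r = assms(2,3)
  note coeff = smooth_on_radius_coefficients[OF r]
  let ?H = "\<lambda>s. pseudo_hypersphere (\<gamma> s) (r s)" and ?Hy = "\<lambda>s. pseudo_hyperbolic_hypersphere (\<gamma> s) (r s)"
  have C123: ?C123 if small: ?small
  proof (intro ballI allI impI)
    fix \<epsilon> :: real and V f g
      and Y :: "(real \<times> real \<Rightarrow> real) \<Rightarrow> (real \<times> real \<Rightarrow> real) \<Rightarrow> real \<times> real \<times> real \<Rightarrow> real^4"
    assume \<epsilon>: "\<epsilon> \<in> {-1, 1}" and adm: "admissible V f g"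
      and Y: "Y \<in> {canal1 \<gamma> F1 F2 F3 F4 r \<epsilon>, canal2 \<gamma> F1 F2 F3 F4 r \<epsilon>, canal3 \<gamma> F1 F2 F3 F4 r \<epsilon>}"
    have b: "smooth_on I (\<lambda>s. \<epsilon> * r s * sqrt (1 - (deriv r s)\<^sup>2))"
      using small by (intro coeff) auto
    have b2: "1 * (\<epsilon> * r s * sqrt (1 - (deriv r s)\<^sup>2))\<^sup>2 = (r s)\<^sup>2 * (1 - (deriv r s)\<^sup>2)" if "s \<in> I" for s
      using \<epsilon> small that by (auto simp: power_mult_distrib less_imp_le)
    have 1: "envelope_on I \<gamma> ?H (I \<times> V) (canal1 \<gamma> F1 F2 F3 F4 r \<epsilon> f g) \<and>
        timelike_on (I \<times> V) (canal1 \<gamma> F1 F2 F3 F4 r \<epsilon> f g)" if "admissible V f g" for f g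
      unfolding canal1_frame_canal
      by (rule frame_canal_timelike_envelope[OF that r refl b b2 smooth_on_sin_cos]) auto
    have 3: "envelope_on I \<gamma> ?H (I \<times> V) (canal3 \<gamma> F1 F2 F3 F4 r \<epsilon> f g) \<and>
        timelike_on (I \<times> V) (canal3 \<gamma> F1 F2 F3 F4 r \<epsilon> f g)"
      unfolding canal3_frame_canal
      by (rule frame_canal_timelike_envelope[OF adm r refl b b2 smooth_on_sinh_cosh(2,1) cosh_sinh_conic])
    show "envelope_on I \<gamma> ?H (I \<times> V) (Y f g) \<and> timelike_on (I \<times> V) (Y f g)"
      using Y 1[OF adm] 3 1[OF admissible_quarter_turn[OF adm]] unfolding canal2_canal1[symmetric] by auto
  qed
  have E123: ?E123 if small: ?small
    unfolding Let_def
  proof (intro allI impI)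
    fix U and X :: "real \<times> real \<times> real \<Rightarrow> real^4"
    assume X: "envelope_on I \<gamma> ?H U X \<and> (\<forall>p\<in>U. regular_at X p)"
    then have reg: "\<And>p. p \<in> U \<Longrightarrow> regular_at X p" by blast
    note env = envelope_facts[OF r(1) X[THEN conjunct1] pseudo_hypersphere_iff, simplified]
    let ?a2 = "\<lambda>p. lorentz (X p - \<gamma> (fst p)) (F2 (fst p))"
      and ?a3 = "\<lambda>p. lorentz (X p - \<gamma> (fst p)) (F4 (fst p))"
      and ?a4 = "\<lambda>p. lorentz (X p - \<gamma> (fst p)) (F3 (fst p))"
    have dense: "U \<subseteq> closure {p \<in> U. ?a3 p * ?a4 p \<noteq> 0}"
    proof (rule null_coordinates_nonzero_dense[OF env(1,2) reg coeff(2) env(4,5)])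
      fix p assume p: "p \<in> U"
      then have "fst p \<in> I" using env(2) by auto
      then have "0 < r (fst p)" "(deriv r (fst p))\<^sup>2 < 1" using small r(2) by auto
      then have "(r (fst p))\<^sup>2 * (deriv r (fst p))\<^sup>2 < (r (fst p))\<^sup>2" by simp
      then have "(- (r (fst p) * deriv r (fst p)))\<^sup>2 < (r (fst p))\<^sup>2"
        unfolding power2_minus power_mult_distrib .
      then show "lorentz (X p - \<gamma> (fst p)) (X p - \<gamma> (fst p)) \<noteq> (- (r (fst p) * deriv r (fst p)))\<^sup>2"
        unfolding env(3)[OF p] by (metis less_irrefl)
    qed
    have param: "parametrized_by I (canal1 \<gamma> F1 F2 F3 F4 r \<epsilon>) (X ` {p \<in> U. ?a3 p * ?a4 p > 0})"
        "parametrized_by I (canal3 \<gamma> F1 F2 F3 F4 r \<epsilon>) (X ` {p \<in> U. ?a3 p * ?a4 p < 0 \<and> \<epsilon> * ?a2 p > 0})"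
      if \<epsilon>: "\<epsilon> \<in> {-1, 1}" for \<epsilon>
    proof -
      let ?b = "\<lambda>s. \<epsilon> * r s * sqrt (1 - (deriv r s)\<^sup>2)"
      have b: "smooth_on I ?b"
        using small by (intro coeff) auto
      have b2: "(- (r s * deriv r s))\<^sup>2 + 1 * (?b s)\<^sup>2 = (r s)\<^sup>2" if "s \<in> I" for s
        using \<epsilon> small that by (auto simp: power_mult_distrib less_imp_le algebra_simps)
      have pos: "r s * sqrt (1 - (deriv r s)\<^sup>2) > 0" if "s \<in> I" for s
        using small that r(2) by simp
      have b0: "?b s \<noteq> 0" if "s \<in> I" for s
        using \<epsilon> pos[OF that] by auto
      have sq: "lorentz (X p - \<gamma> (fst p)) (X p - \<gamma> (fst p))
          = (- (r (fst p) * deriv r (fst p)))\<^sup>2 + 1 * (?b (fst p))\<^sup>2" if "p \<in> U" for p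
        using b2[of "fst p"] env(2,3) that by auto
      have sheet: "?a2 p / ?b (fst p) > 0" if "p \<in> U" "\<epsilon> * ?a2 p > 0" for p
      proof -
        have "?a2 p / ?b (fst p) = \<epsilon> * ?a2 p / (r (fst p) * sqrt (1 - (deriv r (fst p))\<^sup>2))"
          using \<epsilon> by auto
        moreover have "fst p \<in> I" using env(2) that by auto
        ultimately show ?thesis using pos that(2) by simp
      qed
      note op = open_coordinate_condition[OF env(1,2) reg]
      show "parametrized_by I (canal1 \<gamma> F1 F2 F3 F4 r \<epsilon>) (X ` {p \<in> U. ?a3 p * ?a4 p > 0})"
        unfolding canal1_frame_canal
      proof (rule parametrized_by_sin_canal[OF coeff(2) b b0 op(1)])
        fix p assume "p \<in> {p \<in> U. ?a3 p * ?a4 p > 0}"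
        then have p: "p \<in> U" and yz: "?a3 p * ?a4 p > 0" by auto
        show "regular_at X p" by (rule reg[OF p])
        show "lorentz (X p - \<gamma> (fst p)) (F1 (fst p)) = - (r (fst p) * deriv r (fst p))" by (rule env(4)[OF p])
        show "lorentz (X p - \<gamma> (fst p)) (X p - \<gamma> (fst p))
          = (- (r (fst p) * deriv r (fst p)))\<^sup>2 + 1 * (?b (fst p))\<^sup>2" by (rule sq[OF p])
        show "?a3 p * ?a4 p > 0" by (rule yz)
      qed (use env(2) in auto)
      show "parametrized_by I (canal3 \<gamma> F1 F2 F3 F4 r \<epsilon>) (X ` {p \<in> U. ?a3 p * ?a4 p < 0 \<and> \<epsilon> * ?a2 p > 0})"
        unfolding canal3_frame_canal
      proof (rule parametrized_by_cosh_canal[OF coeff(2) b b0 op(2)])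
        fix p assume "p \<in> {p \<in> U. ?a3 p * ?a4 p < 0 \<and> \<epsilon> * ?a2 p > 0}"
        then have p: "p \<in> U" and yz: "?a3 p * ?a4 p < 0" and x: "\<epsilon> * ?a2 p > 0" by auto
        show "regular_at X p" by (rule reg[OF p])
        show "lorentz (X p - \<gamma> (fst p)) (F1 (fst p)) = - (r (fst p) * deriv r (fst p))" by (rule env(4)[OF p])
        show "lorentz (X p - \<gamma> (fst p)) (X p - \<gamma> (fst p))
          = (- (r (fst p) * deriv r (fst p)))\<^sup>2 + 1 * (?b (fst p))\<^sup>2" by (rule sq[OF p])
        show "?a3 p * ?a4 p < 0" by (rule yz)
        show "?a2 p / ?b (fst p) > 0" by (rule sheet[OF p x])
      qed (use env(2) in auto)
    qed
    show "U \<subseteq> closure {p \<in> U. ?a3 p * ?a4 p \<noteq> 0} \<and> (\<forall>\<epsilon>\<in>{-1, 1}.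
        parametrized_by I (canal1 \<gamma> F1 F2 F3 F4 r \<epsilon>) (X ` {p \<in> U. ?a3 p * ?a4 p > 0}) \<and>
        parametrized_by I (canal2 \<gamma> F1 F2 F3 F4 r \<epsilon>) (X ` {p \<in> U. ?a3 p * ?a4 p > 0}) \<and>
        parametrized_by I (canal3 \<gamma> F1 F2 F3 F4 r \<epsilon>)
          (X ` {p \<in> U. ?a3 p * ?a4 p < 0 \<and> \<epsilon> * ?a2 p > 0}))"
      by (intro conjI ballI dense param parametrized_by_canal2)
  qed
  have C4: ?C4 if large: ?large
  proof (intro ballI conjI allI impI)
    fix \<epsilon> :: real assume \<epsilon>: "\<epsilon> \<in> {-1, 1}"
    let ?b = "\<lambda>s. \<epsilon> * r s * sqrt ((deriv r s)\<^sup>2 - 1)"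
    have b: "smooth_on I ?b"
      using large by (intro coeff) auto
    have b2: "(-1) * (?b s)\<^sup>2 = (r s)\<^sup>2 * (1 - (deriv r s)\<^sup>2)" if "s \<in> I" for s
      using \<epsilon> large that by (auto simp: power_mult_distrib less_imp_le algebra_simps)
    have b0: "?b s \<noteq> 0" if "s \<in> I" for s
      using \<epsilon> large that r(2) by force
    show "envelope_on I \<gamma> ?H (I \<times> V) (canal4 \<gamma> F1 F2 F3 F4 r \<epsilon> f g)"
        "timelike_on (I \<times> V) (canal4 \<gamma> F1 F2 F3 F4 r \<epsilon> f g)"
      if "admissible V f g" for V f g
      unfolding canal4_frame_canal
      using frame_canal_timelike_envelope[OF that r refl b b2 smooth_on_sinh_cosh sinh_cosh_conic] by auto
    fix U X assume X: "envelope_on I \<gamma> ?H U X \<and> (\<forall>p\<in>U. regular_at X p)"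
    note env = envelope_facts[OF r(1) X[THEN conjunct1] pseudo_hypersphere_iff, simplified]
    show "parametrized_by I (canal4 \<gamma> F1 F2 F3 F4 r \<epsilon>) (X ` U)"
      unfolding canal4_frame_canal
    proof (rule parametrized_by_sinh_canal[OF coeff(2) b b0 env(1,2) _ env(4)])
      fix p assume p: "p \<in> U"
      show "regular_at X p" using X p by blast
      have s: "fst p \<in> I" using p env(2) by auto
      show "lorentz (X p - \<gamma> (fst p)) (X p - \<gamma> (fst p))
          = (- (r (fst p) * deriv r (fst p)))\<^sup>2 + (-1) * (?b (fst p))\<^sup>2"
        unfolding b2[OF s] env(3)[OF p] by (simp add: power_mult_distrib algebra_simps)
    qed
  qed
  have C5: ?C5
  proof (intro ballI conjI allI impI)
    fix \<epsilon> :: real assume \<epsilon>: "\<epsilon> \<in> {-1, 1}"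
    let ?b = "\<lambda>s. \<epsilon> * r s * sqrt (1 + (deriv r s)\<^sup>2)"
    have b: "smooth_on I ?b" by (rule coeff)
    have pos: "1 + (deriv r s)\<^sup>2 > 0" for s by (simp add: add_pos_nonneg)
    have b2: "(-1) * (?b s)\<^sup>2 = - (r s)\<^sup>2 * (1 + (deriv r s)\<^sup>2)" if "s \<in> I" for s
      using \<epsilon> real_sqrt_pow2[OF less_imp_le[OF pos[of s]]] by (auto simp: power_mult_distrib)
    have b0: "?b s \<noteq> 0" if "s \<in> I" for s
    proof -
      have "sqrt (1 + (deriv r s)\<^sup>2) > 0" using pos by (simp only: real_sqrt_gt_0_iff)
      moreover have "r s > 0" using r(2) that by blast
      ultimately show ?thesis using \<epsilon> by auto
    qed
    show "envelope_on I \<gamma> ?Hy (I \<times> V) (canal5 \<gamma> F1 F2 F3 F4 r \<epsilon> f g)"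
        "spacelike_on (I \<times> V) (canal5 \<gamma> F1 F2 F3 F4 r \<epsilon> f g)"
      if "admissible V f g" for V f g
      unfolding canal5_frame_canal
      using frame_canal_spacelike_envelope[OF that r refl b b2 smooth_on_sinh_cosh sinh_cosh_conic] by auto
    fix U X assume X: "envelope_on I \<gamma> ?Hy U X \<and> (\<forall>p\<in>U. regular_at X p)"
    note env = envelope_facts[OF r(1) X[THEN conjunct1] pseudo_hyperbolic_hypersphere_iff, simplified]
    show "parametrized_by I (canal5 \<gamma> F1 F2 F3 F4 r \<epsilon>) (X ` U)"
      unfolding canal5_frame_canal
    proof (rule parametrized_by_sinh_canal[OF coeff(1) b b0 env(1,2) _ env(4)])
      fix p assume p: "p \<in> U"
      show "regular_at X p" using X p by blast
      have s: "fst p \<in> I" using p env(2) by auto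
      show "lorentz (X p - \<gamma> (fst p)) (X p - \<gamma> (fst p))
          = (r (fst p) * deriv r (fst p))\<^sup>2 + (-1) * (?b (fst p))\<^sup>2"
        unfolding b2[OF s] env(3)[OF p] by (simp add: power_mult_distrib algebra_simps)
    qed
  qed
  show ?thesis
  proof (intro conjI impI)
    show ?C123 if ?small using that by (rule C123)
    show ?E123 if ?small using that by (rule E123)
    show ?C4 if ?large using that by (rule C4)
    show ?C5 by (rule C5)
  qed
qed

end
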